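(* Let $\Sigma=\partial\Omega\subset\mathbb{R}^3$ be a static scene, let a camera move inside $\Omega$ with linear velocity $v(t)$ and angular velocity $\omega(t)$, and let $D(t,\eta)$, $\Gamma(t,\eta)=1/D(t,\eta)$ ($t\ge 0$, $\eta\in\mathbb{S}^2$) be the associated depth and inverse depth fields, all as defined in the context. Assume that there exist $\bar v>0$, $\bar\omega>0$, $\bar\gamma>0$ and $\bar\Gamma>0$ such that $$\forall t\ge 0,\ \forall\eta\in\mathbb{S}^2,\quad |v(t)|\le\bar v,\quad |\omega(t)|\le\bar\omega,\quad \bar\gamma\le\Gamma(t,\eta)\le\bar\Gamma .$$ Then, for $t\ge 0$, $\Gamma(t,\eta)$ is a $C^1$ solution of $$\frac{\partial\Gamma}{\partial t}=-\nabla\Gamma\cdot\big(\eta\times(\omega+\Gamma\,\eta\times v)\big)+\Gamma^2\,v\cdot\eta .$$ Moreover, let $k>0$ and consider the observer $$\frac{\partial\widehat D}{\partial t}=-\nabla\widehat D\cdot\varpi_t-v\cdot\eta+k\,g_t\cdot\big(\widehat D f_t+g_t-\widehat D\varpi_t\big)$$ on $\mathbb{S}^2$, with an initial condition $\widehat D(0,\eta)$ that is $C^1$ with respect to $\eta$, where $f_t(\eta)=\eta\times\omega(t)$, $g_t(\eta)=\eta\times(\eta\times v(t))$ and $\varpi_t(\eta)=f_t(\eta)+\Gamma(t,\eta)g_t(\eta)$. Let $\phi(t,s)$ be the flow of $\varpi_t$ on $\mathbb{S}^2$, i.e. $\frac{\partial\phi}{\partial t}\big|_{(t,s)}=\varpi_t(\phi(t,s))$,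 $\phi(0,s)=s\in\mathbb{S}^2$. Then: (1) For all $t\ge 0$ the solution $\widehat D(t,\eta)$ of the observer equation exists, is unique and remains $C^1$ with respect to $\eta$. Moreover $$t\mapsto\|\widehat D(t,\cdot)-D(t,\cdot)\|_{L^\infty}=\max_{\eta\in\mathbb{S}^2}\big|\widehat D(t,\eta)-D(t,\eta)\big|$$ is decreasing (in the non-strict sense). (2) If additionally $\int_0^{+\infty}\|g_\tau(\phi(\tau,s))\|^2\,d\tau=+\infty$ for all $s\in\mathbb{S}^2$, then for all $p>0$, $$\lim_{t\to+\infty}\int_{\mathbb{S}^2}\big|\widehat D(t,\eta)-D(t,\eta)\big|^p\,d\sigma_\eta=0 .$$ (3) If additionally there are $\lambda>0$ and $T>0$ such that $\int_0^t\|g_\tau(\phi(\tau,s))\|^2\,d\tau\ge\lambda t$ for all $t\ge T$ and all $s\in\mathbb{S}^2$, then for all $t\ge T$, $$\|\widehat D(t,\cdot)-D(t,\cdot)\|_{L^\infty}\le e^{-k\bar\gamma\lambda t}\,\|\widehat D(0,\cdot)-D(0,\cdot)\|_{L^\infty}.$$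
   Context: Scene and camera. $\Sigma\subset\mathbb{R}^3$ is a closed, $C^1$, convex surface, diffeomorphic to the unit sphere $\mathbb{S}^2$, and $\Omega$ is the domain it delimits, $\Sigma=\partial\Omega$. The scene is static. A camera with optical center $C(t)\in\Omega$ (expressed in a fixed reference frame) and orientation given by a unit quaternion $q(t)$ moves inside $\Omega$ for $t\ge 0$: identifying vectors of $\mathbb{R}^3$ with imaginary quaternions, a vector $\varsigma$ in the camera frame corresponds to the vector $q\varsigma q^*$ in the reference frame ($q^*$ is the conjugate of $q$). The linear and angular velocities $v(t),\omega(t)\in\mathbb{R}^3$ are expressed in the camera frame, so $\frac{d}{dt}C=q v q^*$ and $\frac{d}{dt}q=\frac12 q\omega$; $v$ and $\omega$ are continuous functions of $t$. Depth. For $\eta\in\mathbb{S}^2$ (a unit vector in the camera frame, i.e. a pixel), there is exactly one point $M\in\Sigma$ seen from $C(t)$ in direction $\eta$, i.e. with $q(t)\eta q(t)^*=\overrightarrow{C(t)M}/\|\overrightarrow{C(t)M}\|$. The depth $D(t,\eta)$ is the distance $\|\overrightarrow{C(t)M}\|$, and $\Gamma(t,\eta)=1/D(t,\eta)$. Scene points can be labelled by $s\in\mathbb{S}^2$, where $M(s)$ is the point seen at time $0$ in direction $s$; the flow $\phi(t,s)$ is then the direction, in the camera frame, in which $M(s)$ is seen at time $t$. Notation. $\nabla h$ is the gradient of a scalar field $h$ on $\mathbb{S}^2$ for the standard Riemannian metric, viewed at each $\eta$ as a vector of $\mathbb{R}^3$ tangent to the sphere at $\eta$; $a\cdot b$ and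 $a\times b$ are the Euclidean scalar product and cross product in $\mathbb{R}^3$; $d\sigma_\eta$ is the Riemannian surface element on $\mathbb{S}^2$. The solution of the observer equation is understood in the classical sense. *)

theory Defs
  imports "HOL-Analysis.Analysis"
begin

subsection \<open>Functions of class C1 on subsets, C1 surfaces\<close>

text \<open>
  A function on an arbitrary set is C1 if near every point of the set it is the restriction of a
  C1 function defined on an open set of the ambient space. On a submanifold, possibly with
  boundary, this is the usual notion; it is applied below to the unit sphere, to surfaces
  in three-space and to the product of a closed half-line and the unit sphere.
\<close>

definition C1_on ::
    "'a::euclidean_space set \<Rightarrow> ('a \<Rightarrow> 'b::real_normed_vector) \<Rightarrow> bool" where
  "C1_on S f \<longleftrightarrow>
     (\<forall>p\<in>S. \<exists>U F F'. open U \<and> p \<in> U \<and>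
        (\<forall>x\<in>U. (F has_derivative blinfun_apply (F' x)) (at x)) \<and>
        continuous_on U (F' :: 'a \<Rightarrow> 'a \<Rightarrow>\<^sub>L 'b) \<and>
        (\<forall>x\<in>S \<inter> U. F x = f x))"

definition C1_diffeomorphic ::
    "'a::euclidean_space set \<Rightarrow> 'b::euclidean_space set \<Rightarrow> bool" where
  "C1_diffeomorphic S T \<longleftrightarrow> (\<exists>f g. homeomorphism S T f g \<and> C1_on S f \<and> C1_on T g)"

text \<open>An embedded C1 surface, given locally as a regular level set.\<close>

definition C1_surface :: "(real^3) set \<Rightarrow> bool" where
  "C1_surface S \<longleftrightarrow>
     (\<forall>p\<in>S. \<exists>U F F'. open U \<and> p \<in> U \<and>
        (\<forall>x\<in>U. (F has_derivative (\<lambda>h. F' x \<bullet> h)) (at x)) \<and>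
        continuous_on U F' \<and> (\<forall>x\<in>U. F' x \<noteq> 0) \<and>
        S \<inter> U = {x\<in>U. F x = (0::real)})"

definition convex_C1_scene :: "(real^3) set \<Rightarrow> (real^3) set \<Rightarrow> bool" where
  "convex_C1_scene \<Omega> \<Sigma> \<longleftrightarrow>
     open \<Omega> \<and> bounded \<Omega> \<and> \<Omega> \<noteq> {} \<and> convex \<Omega> \<and> \<Sigma> = frontier \<Omega> \<and>
     C1_surface \<Sigma> \<and> C1_diffeomorphic (sphere 0 1 :: (real^3) set) \<Sigma>"


subsection \<open>Quaternions and camera motion\<close>

text \<open>
  A quaternion is the pair of its real part and its imaginary part; the norm of the product type
  is the quaternion norm.
\<close>

type_synonym quat = "real \<times> (real^3)"

definition qmult :: "quat \<Rightarrow> quat \<Rightarrow> quat" where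
  "qmult x y = (fst x * fst y - snd x \<bullet> snd y,
                fst x *\<^sub>R snd y + fst y *\<^sub>R snd x + cross3 (snd x) (snd y))"

definition qconj :: "quat \<Rightarrow> quat" where
  "qconj x = (fst x, - snd x)"

definition qimag :: "real^3 \<Rightarrow> quat" where
  "qimag u = (0, u)"

text \<open>The product below is purely imaginary, so taking its imaginary part loses nothing.\<close>

definition qrotate :: "quat \<Rightarrow> real^3 \<Rightarrow> real^3" where
  "qrotate x u = snd (qmult (qmult x (qimag u)) (qconj x))"

definition camera_motion ::
    "(real^3) set \<Rightarrow> (real \<Rightarrow> real^3) \<Rightarrow> (real \<Rightarrow> quat) \<Rightarrow>
     (real \<Rightarrow> real^3) \<Rightarrow> (real \<Rightarrow> real^3) \<Rightarrow> bool" where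
  "camera_motion \<Omega> C q v \<omega> \<longleftrightarrow>
     continuous_on {0..} v \<and> continuous_on {0..} \<omega> \<and>
     (\<forall>t\<ge>0. C t \<in> \<Omega> \<and> norm (q t) = 1 \<and>
        (C has_vector_derivative qrotate (q t) (v t)) (at t within {0..}) \<and>
        (q has_vector_derivative (1/2) *\<^sub>R qmult (q t) (qimag (\<omega> t))) (at t within {0..}))"

definition seen_point :: "(real^3) set \<Rightarrow> real^3 \<Rightarrow> quat \<Rightarrow> real^3 \<Rightarrow> real^3" where
  "seen_point \<Sigma> c x \<eta> = (THE M. M \<in> \<Sigma> \<and> qrotate x \<eta> = (M - c) /\<^sub>R norm (M - c))"

definition depth :: "(real^3) set \<Rightarrow> real^3 \<Rightarrow> quat \<Rightarrow> real^3 \<Rightarrow> real" where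
  "depth \<Sigma> c x \<eta> = norm (seen_point \<Sigma> c x \<eta> - c)"


subsection \<open>Calculus on the unit sphere\<close>

text \<open>
  The derivative within the sphere only constrains the values on tangent vectors, so the
  tangential vector representing it is unique.
\<close>

definition sphere_grad :: "(real^3 \<Rightarrow> real) \<Rightarrow> real^3 \<Rightarrow> real^3" where
  "sphere_grad h \<eta> =
     (THE w. w \<bullet> \<eta> = 0 \<and> (h has_derivative (\<lambda>x. w \<bullet> x)) (at \<eta> within sphere 0 1))"

definition sphere_coord :: "real \<times> real \<Rightarrow> real^3" where
  "sphere_coord = (\<lambda>(\<theta>, \<phi>). vector [sin \<theta> * cos \<phi>, sin \<theta> * sin \<phi>, cos \<theta>])"

text \<open>
  The metric pulled back by these coordinates is $d\theta^2 + \sin^2\theta\, d\phi^2$, whence the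
  Riemannian surface element $\sin\theta\, d\theta\, d\phi$; the overlap and the poles form a null
  set. The underlying space of the measure is the sphere, so that integrands only matter there.
\<close>

definition sphere_measure :: "(real^3) measure" where
  "sphere_measure =
     distr (density (restrict_space lborel {(\<theta>, \<phi>). 0 \<le> \<theta> \<and> \<theta> \<le> pi \<and> 0 \<le> \<phi> \<and> \<phi> \<le> 2 * pi})
             (\<lambda>(\<theta>, \<phi>). ennreal (sin \<theta>)))
           (restrict_space borel (sphere 0 1)) sphere_coord"

text \<open>
  For continuous functions, the only ones it is used for, this is the maximum of the absolute
  value and the norm of the space of essentially bounded functions.
\<close>

definition sphere_sup_norm :: "(real^3 \<Rightarrow> real) \<Rightarrow> real" where
  "sphere_sup_norm h = (SUP \<eta>\<in>sphere 0 1. \<bar>h \<eta>\<bar>)"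


subsection \<open>The observer\<close>

definition f_field :: "(real \<Rightarrow> real^3) \<Rightarrow> real \<Rightarrow> real^3 \<Rightarrow> real^3" where
  "f_field \<omega> t \<eta> = cross3 \<eta> (\<omega> t)"

definition g_field :: "(real \<Rightarrow> real^3) \<Rightarrow> real \<Rightarrow> real^3 \<Rightarrow> real^3" where
  "g_field v t \<eta> = cross3 \<eta> (cross3 \<eta> (v t))"

definition flow_field ::
    "(real \<Rightarrow> real^3) \<Rightarrow> (real \<Rightarrow> real^3) \<Rightarrow> (real \<Rightarrow> real^3 \<Rightarrow> real) \<Rightarrow>
     real \<Rightarrow> real^3 \<Rightarrow> real^3" where
  "flow_field v \<omega> \<Gamma> t \<eta> = f_field \<omega> t \<eta> + \<Gamma> t \<eta> *\<^sub>R g_field v t \<eta>"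

definition is_sphere_flow ::
    "(real \<Rightarrow> real^3 \<Rightarrow> real^3) \<Rightarrow> (real \<Rightarrow> real^3 \<Rightarrow> real^3) \<Rightarrow> bool" where
  "is_sphere_flow X \<phi> \<longleftrightarrow>
     (\<forall>s\<in>sphere 0 1. \<phi> 0 s = s \<and>
        (\<forall>t\<ge>0. \<phi> t s \<in> sphere 0 1 \<and>
           ((\<lambda>\<tau>. \<phi> \<tau> s) has_vector_derivative X t (\<phi> t s)) (at t within {0..})))"

abbreviation time_sphere :: "(real \<times> (real^3)) set" where
  "time_sphere \<equiv> {(t, \<eta>). 0 \<le> t \<and> \<eta> \<in> sphere 0 1}"

text \<open>
  A classical solution is a differentiable function that satisfies the equation pointwise. Values
  outside nonnegative times and the unit sphere are irrelevant.
\<close>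

definition observer_solution ::
    "real \<Rightarrow> (real \<Rightarrow> real^3) \<Rightarrow> (real \<Rightarrow> real^3) \<Rightarrow> (real \<Rightarrow> real^3 \<Rightarrow> real) \<Rightarrow>
     (real^3 \<Rightarrow> real) \<Rightarrow> (real \<Rightarrow> real^3 \<Rightarrow> real) \<Rightarrow> bool" where
  "observer_solution k v \<omega> \<Gamma> D\<^sub>0 Dh \<longleftrightarrow>
     (\<lambda>(t, \<eta>). Dh t \<eta>) differentiable_on time_sphere \<and>
     (\<forall>\<eta>\<in>sphere 0 1. Dh 0 \<eta> = D\<^sub>0 \<eta>) \<and>
     (\<forall>t\<ge>0. \<forall>\<eta>\<in>sphere 0 1.
        ((\<lambda>\<tau>. Dh \<tau> \<eta>) has_real_derivative
           (- (sphere_grad (Dh t) \<eta> \<bullet> flow_field v \<omega> \<Gamma> t \<eta>) - v t \<bullet> \<eta>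
            + k * (g_field v t \<eta> \<bullet>
                (Dh t \<eta> *\<^sub>R f_field \<omega> t \<eta> + g_field v t \<eta>
                 - Dh t \<eta> *\<^sub>R flow_field v \<omega> \<Gamma> t \<eta>))))
          (at t within {0..}))"

end

theory Submission
  imports Defs
begin

text \<open>
  A static scene makes the characteristics explicit. The direction \<open>view t M\<close> in which a scene point
  \<open>M\<close> is seen moves with velocity \<open>\<varpi>\<^sub>t\<close>, so \<open>\<phi>(t, s) = view t M(s)\<close> and no existence theorem for
  ordinary differential equations is needed. The depth is the radial function of a convex domain,
  which is \<open>C\<^sup>1\<close> by the implicit function theorem, and along a characteristic it is \<open>|M - C(t)|\<close>; this
  yields the equations for \<open>D\<close> and \<open>\<Gamma>\<close>. Since \<open>\<Gamma> D = 1\<close>, the observer error \<open>E\<close> satisfies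
  \<open>E' = - k \<Gamma> |g|\<^sup>2 E\<close> along characteristics, hence
  \<open>E(t, view t M) = E(0, view 0 M) exp (- k \<integral>\<^sub>0\<^sup>t \<Gamma> |g|\<^sup>2)\<close>. The integral is a \<open>C\<^sup>1\<close> function of \<open>(t, M)\<close>,
  so this formula provides the unique solution, and all the bounds can be read off it.
\<close>

subsection \<open>Calculus of \<open>C\<^sup>1\<close> functions on arbitrary sets\<close>

text \<open>The velocities are only continuous in time, and so is the integrand of the decay factor.
  Labelling by scene points copes with this: a label does not move, and at each time the passage
  between pixels and labels is explicit in both directions. The observer equation can be required
  along labels instead of at pixels, since labels reach every pixel at every time; for a merely
  differentiable solution this is just the chain rule, so uniqueness holds in that class. Convexity
  enters through rays: each meets the surface once and transversally, which is the condition of the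
  implicit function theorem. The decay factor is differentiated under the integral with respect to
  \<open>M\<close>; the upper bound \<open>\<Gamma>bar\<close> keeps the camera at distance at least
  \<open>1 / \<Gamma>bar\<close> from the scene, so one neighbourhood of the surface serves all
  times. The lower bound \<open>\<gamma>bar\<close> turns divergence of the integral of |g|^2 into
  divergence of the exponent and produces the rate in the last claim.\<close>

lemma C1_on_openI:
  fixes f :: "'a::euclidean_space \<Rightarrow> 'b::real_normed_vector"
  assumes "open S" and d: "\<And>x. x \<in> S \<Longrightarrow> (f has_derivative f' x) (at x)"
    and c: "\<And>h. continuous_on S (\<lambda>x. f' x h)"
  shows "C1_on S f"
proof -
  have bl: "blinfun_apply (Blinfun (f' x)) = f' x" if "x \<in> S" for x
    using bounded_linear_Blinfun_apply[OF has_derivative_bounded_linear[OF d[OF that]]] .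
  have "continuous_on S (\<lambda>x. Blinfun (f' x))"
    using c by (intro continuous_on_blinfun_componentwise) (simp add: bl cong: continuous_on_cong)
  with d show ?thesis
    unfolding C1_on_def
    by (intro ballI exI[of _ S] exI[of _ f] exI[of _ "\<lambda>x. Blinfun (f' x)"] conjI)
      (simp_all add: bl \<open>open S\<close>)
qed

text \<open>The local extensions at different points need not agree, but on an open set each has the
  derivative of \<open>f\<close> itself, so \<open>frechet_derivative\<close> glues them into one
  field, whose continuity is checked locally.\<close>

lemma C1_on_openE:
  fixes f :: "'a::euclidean_space \<Rightarrow> 'b::real_normed_vector"
  assumes "C1_on S f" "open S"
  obtains f' where "\<And>x. x \<in> S \<Longrightarrow> (f has_derivative blinfun_apply (f' x)) (at x)" "continuous_on S f'"
proof -
  define f' where "f' x = Blinfun (frechet_derivative f (at x))" for x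
  have *: "(f has_derivative blinfun_apply (f' p)) (at p) \<and> continuous (at p) f'" if p: "p \<in> S" for p
  proof -
    obtain U F F' where U: "open U" "p \<in> U"
      and F: "\<forall>x\<in>U. (F has_derivative blinfun_apply (F' x)) (at x)"
      "continuous_on U F'" "\<forall>x\<in>S \<inter> U. F x = f x"
      using assms(1)[unfolded C1_on_def, THEN bspec, OF p] by (elim exE conjE)
    have d: "(f has_derivative blinfun_apply (F' x)) (at x)" if x: "x \<in> S \<inter> U" for x
      by (rule has_derivative_transform_within_open[of F _ x UNIV "S \<inter> U"])
        (use x bspec[OF F(1), of x] bspec[OF F(3)] U(1) assms(2) in auto)
    then have e: "f' x = F' x" if "x \<in> S \<inter> U" for x
      unfolding f'_def using frechet_derivative_at[OF d[OF that]] by (metis blinfun_apply_inverse)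
    have "continuous_on (S \<inter> U) F'"
      by (rule continuous_on_subset[OF F(2)]) simp
    then have "continuous_on (S \<inter> U) f'"
      using e by (subst continuous_on_cong[OF refl]) auto
    then have "continuous (at p) f'"
      using U assms(2) p by (simp add: continuous_on_eq_continuous_at open_Int)
    then show ?thesis
      using d[of p] e[of p] p U by simp
  qed
  show ?thesis
    by (rule that[of f']) (use * in \<open>auto intro!: continuous_at_imp_continuous_on\<close>)
qed

text \<open>Together with \<open>C1_onE\<close> this reduces closure properties on arbitrary sets to
  open sets, where derivatives are available.\<close>

lemma C1_on_locallyI:
  assumes "\<And>p. p \<in> S \<Longrightarrow> \<exists>U g. open U \<and> p \<in> U \<and> C1_on U g \<and> (\<forall>x\<in>S \<inter> U. g x = f x)"
  shows "C1_on S f"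
  unfolding C1_on_def
proof
  fix p assume "p \<in> S"
  from assms[OF this] obtain U g where U: "open U" "p \<in> U" "C1_on U g" and eq: "\<forall>x\<in>S \<inter> U. g x = f x"
    by blast
  obtain g' where g': "\<And>x. x \<in> U \<Longrightarrow> (g has_derivative blinfun_apply (g' x)) (at x)" "continuous_on U g'"
    using C1_on_openE[OF U(3,1)] by blast
  show "\<exists>U F F'. open U \<and> p \<in> U \<and> (\<forall>x\<in>U. (F has_derivative blinfun_apply (F' x)) (at x)) \<and>
      continuous_on U F' \<and> (\<forall>x\<in>S \<inter> U. F x = f x)"
    by (intro exI[of _ U] exI[of _ g] exI[of _ g'] conjI ballI) (use U eq g' in simp_all)
qed

lemma C1_onE:
  fixes f :: "'a::euclidean_space \<Rightarrow> 'b::real_normed_vector"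
  assumes "C1_on S f" "p \<in> S"
  obtains U g where "open U" "p \<in> U" "C1_on U g" "\<And>x. x \<in> S \<Longrightarrow> x \<in> U \<Longrightarrow> g x = f x"
proof -
  obtain U F F' where U: "open U" "p \<in> U"
    and F: "\<forall>x\<in>U. (F has_derivative blinfun_apply (F' x)) (at x)"
    "continuous_on U F'" "\<forall>x\<in>S \<inter> U. F x = f x"
    using assms(1)[unfolded C1_on_def, THEN bspec, OF assms(2)] by (elim exE conjE)
  have "C1_on U F"
    by (rule C1_on_openI[OF U(1) bspec[OF F(1)]]) (use F(2) in \<open>auto intro!: continuous_intros\<close>)
  with U F(3) show ?thesis
    by (intro that[of U F]) auto
qed

lemma C1_on_subset:
  fixes f :: "'a::euclidean_space \<Rightarrow> 'b::real_normed_vector"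
  assumes "C1_on S f" "T \<subseteq> S"
  shows "C1_on T f"
proof (rule C1_on_locallyI)
  fix p assume "p \<in> T"
  with assms(2) have p: "p \<in> S" ..
  obtain U g where U: "open U" "p \<in> U" "C1_on U g" and eq: "\<And>x. x \<in> S \<Longrightarrow> x \<in> U \<Longrightarrow> g x = f x"
    using C1_onE[OF assms(1) p] by blast
  then show "\<exists>U g. open U \<and> p \<in> U \<and> C1_on U g \<and> (\<forall>x\<in>T \<inter> U. g x = f x)"
    using assms(2) by (intro exI[of _ U] exI[of _ g]) auto
qed

lemma C1_on_cong:
  assumes "\<And>x. x \<in> S \<Longrightarrow> f x = g x"
  shows "C1_on S f \<longleftrightarrow> C1_on S g"
  using assms unfolding C1_on_def by auto

lemma C1_on_compose:
  fixes f :: "'a::euclidean_space \<Rightarrow> 'b::euclidean_space"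
    and g :: "'b \<Rightarrow> 'c::real_normed_vector"
  assumes f: "C1_on S f" and g: "C1_on T g" and sub: "\<And>x. x \<in> S \<Longrightarrow> f x \<in> T"
  shows "C1_on S (\<lambda>x. g (f x))"
proof (rule C1_on_locallyI)
  fix p assume p: "p \<in> S"
  obtain U F where U: "open U" "p \<in> U" "C1_on U F" and eqF: "\<And>x. x \<in> S \<Longrightarrow> x \<in> U \<Longrightarrow> F x = f x"
    using C1_onE[OF f p] by blast
  obtain V G where V: "open V" "f p \<in> V" "C1_on V G" and eqG: "\<And>x. x \<in> T \<Longrightarrow> x \<in> V \<Longrightarrow> G x = g x"
    using C1_onE[OF g sub[OF p]] by blast
  obtain F' where F: "\<And>x. x \<in> U \<Longrightarrow> (F has_derivative blinfun_apply (F' x)) (at x)" "continuous_on U F'"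
    using C1_on_openE[OF U(3,1)] by blast
  obtain G' where G: "\<And>x. x \<in> V \<Longrightarrow> (G has_derivative blinfun_apply (G' x)) (at x)" "continuous_on V G'"
    using C1_on_openE[OF V(3,1)] by blast
  have cF: "continuous_on U F"
    by (intro continuous_at_imp_continuous_on ballI) (rule has_derivative_continuous[OF F(1)])
  \<comment> \<open>The extension \<open>F\<close> may leave the domain of \<open>G\<close> even
    where \<open>f\<close> stays in \<open>T\<close>, so the neighbourhood is shrunk.\<close>
  let ?W = "F -` V \<inter> U"
  have oW: "open ?W"
    using cF U(1) V(1) by (simp add: continuous_on_open_vimage)
  have "C1_on ?W (\<lambda>x. G (F x))"
  proof (rule C1_on_openI[OF oW])
    show "((\<lambda>x. G (F x)) has_derivative (\<lambda>h. G' (F x) (F' x h))) (at x)" if "x \<in> ?W" for x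
      by (rule has_derivative_compose[of F _ x UNIV, OF F(1) G(1)]) (use that in auto)
    show "continuous_on ?W (\<lambda>x. G' (F x) (F' x h))" for h
    proof (intro continuous_intros)
      show "continuous_on ?W (\<lambda>x. G' (F x))"
        by (rule continuous_on_compose2[OF G(2) continuous_on_subset[OF cF]]) auto
      show "continuous_on ?W F'"
        by (rule continuous_on_subset[OF F(2)]) auto
    qed
  qed
  then show "\<exists>U h. open U \<and> p \<in> U \<and> C1_on U h \<and> (\<forall>x\<in>S \<inter> U. h x = g (f x))"
    using oW U V eqF eqG sub p by (intro exI[of _ ?W] exI[of _ "\<lambda>x. G (F x)"]) auto
qed

lemma C1_on_has_derivative:
  fixes f :: "'a::euclidean_space \<Rightarrow> 'b::real_normed_vector"
  assumes "C1_on S f" "p \<in> S"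
  shows "\<exists>f'. (f has_derivative f') (at p within S)"
proof -
  obtain U F where U: "open U" "p \<in> U" "C1_on U F" and eq: "\<And>x. x \<in> S \<Longrightarrow> x \<in> U \<Longrightarrow> F x = f x"
    using C1_onE[OF assms] by blast
  obtain F' where F: "\<And>x. x \<in> U \<Longrightarrow> (F has_derivative blinfun_apply (F' x)) (at x)"
    using C1_on_openE[OF U(3,1)] by blast
  obtain e where e: "e > 0" "ball p e \<subseteq> U"
    using U(1,2) openE by blast
  have "(f has_derivative blinfun_apply (F' p)) (at p within S)"
    by (rule has_derivative_transform_within[OF has_derivative_at_withinI[OF F[OF U(2)]] e(1) assms(2)])
      (use e in \<open>auto intro!: eq simp: dist_commute subset_iff\<close>)
  then show ?thesis
    by (rule exI[of _ "blinfun_apply (F' p)"])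
qed

lemma C1_on_differentiable_on:
  fixes f :: "'a::euclidean_space \<Rightarrow> 'b::real_normed_vector"
  shows "C1_on S f \<Longrightarrow> f differentiable_on S"
  using C1_on_has_derivative unfolding differentiable_on_def differentiable_def by blast

lemma C1_on_continuous_on:
  fixes f :: "'a::euclidean_space \<Rightarrow> 'b::real_normed_vector"
  shows "C1_on S f \<Longrightarrow> continuous_on S f"
  by (simp add: C1_on_differentiable_on differentiable_imp_continuous_on)

section \<open>Closure properties of C1 functions\<close>

lemma C1_on_const: "C1_on S (\<lambda>x. c)"
  by (rule C1_on_subset[OF C1_on_openI[of UNIV]]) (auto intro: has_derivative_const)

lemma C1_on_bounded_linear:
  assumes "bounded_linear L"
  shows "C1_on S L"
  by (rule C1_on_subset[OF C1_on_openI[of UNIV _ "\<lambda>_. L"]])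
    (use assms in \<open>auto intro: bounded_linear_imp_has_derivative\<close>)

lemma C1_on_ident: "C1_on S (\<lambda>x. x)"
  by (rule C1_on_bounded_linear) (rule bounded_linear_ident)

lemma C1_on_Pair:
  assumes f: "C1_on S f" and g: "C1_on S g"
  shows "C1_on S (\<lambda>x. (f x, g x))"
proof (rule C1_on_locallyI)
  fix p assume p: "p \<in> S"
  obtain U F where U: "open U" "p \<in> U" "C1_on U F" and eqF: "\<And>x. x \<in> S \<Longrightarrow> x \<in> U \<Longrightarrow> F x = f x"
    using C1_onE[OF f p] by blast
  obtain V G where V: "open V" "p \<in> V" "C1_on V G" and eqG: "\<And>x. x \<in> S \<Longrightarrow> x \<in> V \<Longrightarrow> G x = g x"
    using C1_onE[OF g p] by blast
  obtain F' where F: "\<And>x. x \<in> U \<Longrightarrow> (F has_derivative blinfun_apply (F' x)) (at x)" "continuous_on U F'"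
    using C1_on_openE[OF U(3,1)] by blast
  obtain G' where G: "\<And>x. x \<in> V \<Longrightarrow> (G has_derivative blinfun_apply (G' x)) (at x)" "continuous_on V G'"
    using C1_on_openE[OF V(3,1)] by blast
  have oW: "open (U \<inter> V)"
    using U V by blast
  have "C1_on (U \<inter> V) (\<lambda>x. (F x, G x))"
  proof (rule C1_on_openI[OF oW])
    show "((\<lambda>x. (F x, G x)) has_derivative (\<lambda>h. (F' x h, G' x h))) (at x)" if "x \<in> U \<inter> V" for x
      by (rule has_derivative_Pair[OF F(1) G(1)]) (use that in auto)
    show "continuous_on (U \<inter> V) (\<lambda>x. (F' x h, G' x h))" for h
      by (intro continuous_intros continuous_on_subset[OF F(2)] continuous_on_subset[OF G(2)]) auto
  qed
  then show "\<exists>U h. open U \<and> p \<in> U \<and> C1_on U h \<and> (\<forall>x\<in>S \<inter> U. h x = (f x, g x))"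
    using oW U V eqF eqG by (intro exI[of _ "U \<inter> V"] exI[of _ "\<lambda>x. (F x, G x)"]) auto
qed

lemma C1_on_bounded_bilinear:
  fixes prod :: "'b::euclidean_space \<Rightarrow> 'c::euclidean_space \<Rightarrow> 'd::real_normed_vector"
  assumes "bounded_bilinear prod" and f: "C1_on S f" and g: "C1_on S g"
  shows "C1_on S (\<lambda>x. prod (f x) (g x))"
proof -
  interpret bounded_bilinear prod by fact
  have "C1_on UNIV (\<lambda>z. prod (fst z) (snd z))"
  proof (rule C1_on_openI)
    show "((\<lambda>z. prod (fst z) (snd z)) has_derivative
        (\<lambda>h. prod (fst z) (snd h) + prod (fst h) (snd z))) (at z)" for z
      by (rule FDERIV; rule derivative_eq_intros; simp)
    show "continuous_on UNIV (\<lambda>z. prod (fst z) (snd h) + prod (fst h) (snd z))" for h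
      by (intro continuous_intros continuous_on)
  qed auto
  from C1_on_compose[OF C1_on_Pair[OF f g] this] show ?thesis
    by simp
qed

lemma bounded_bilinear_cross3: "bounded_bilinear cross3"
  using bilinear_cross bilinear_conv_bounded_bilinear by blast

lemmas C1_on_inner = C1_on_bounded_bilinear[OF bounded_bilinear_inner]
lemmas C1_on_scaleR = C1_on_bounded_bilinear[OF bounded_bilinear_scaleR]
lemmas C1_on_mult = C1_on_bounded_bilinear[OF bounded_bilinear_mult]
lemmas C1_on_cross3 = C1_on_bounded_bilinear[OF bounded_bilinear_cross3]

lemma C1_on_bounded_linear_compose:
  fixes f :: "'a::euclidean_space \<Rightarrow> 'b::euclidean_space"
  assumes "bounded_linear L" "C1_on S f"
  shows "C1_on S (\<lambda>x. L (f x))"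
  by (rule C1_on_compose[OF assms(2) C1_on_bounded_linear[OF assms(1), of UNIV]]) simp

lemmas C1_on_fst = C1_on_bounded_linear_compose[OF bounded_linear_fst]
lemmas C1_on_snd = C1_on_bounded_linear_compose[OF bounded_linear_snd]
lemmas C1_on_minus = C1_on_bounded_linear_compose[OF bounded_linear_minus[OF bounded_linear_ident]]

lemma C1_on_add:
  fixes f g :: "'a::euclidean_space \<Rightarrow> 'b::euclidean_space"
  assumes "C1_on S f" "C1_on S g"
  shows "C1_on S (\<lambda>x. f x + g x)"
proof -
  have "bounded_linear (\<lambda>z::'b\<times>'b. fst z + snd z)"
    by (intro bounded_linear_add bounded_linear_fst bounded_linear_snd)
  from C1_on_bounded_linear_compose[OF this C1_on_Pair[OF assms]] show ?thesis
    by simp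
qed

lemma C1_on_diff:
  fixes f g :: "'a::euclidean_space \<Rightarrow> 'b::euclidean_space"
  assumes "C1_on S f" "C1_on S g"
  shows "C1_on S (\<lambda>x. f x - g x)"
  using C1_on_add[OF assms(1) C1_on_minus[OF assms(2)]] by simp

lemma C1_on_real_compose:
  fixes f :: "'a::euclidean_space \<Rightarrow> real"
  assumes f: "C1_on S f" and "open T" and "\<And>x. x \<in> S \<Longrightarrow> f x \<in> T"
    and g: "\<And>y. y \<in> T \<Longrightarrow> (g has_real_derivative g' y) (at y)" "continuous_on T g'"
  shows "C1_on S (\<lambda>x. g (f x))"
proof (rule C1_on_compose[OF f _ assms(3)])
  show "C1_on T g"
    by (rule C1_on_openI[OF \<open>open T\<close>, where f' = "\<lambda>y h. g' y * h"])
      (use g in \<open>auto simp: has_field_derivative_def intro!: continuous_intros\<close>)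
qed

lemma C1_on_exp: "C1_on S f \<Longrightarrow> C1_on S (\<lambda>x. exp (f x :: real))"
  by (rule C1_on_real_compose[of S f UNIV exp exp]) (auto intro: DERIV_exp continuous_intros)

lemma C1_on_inverse:
  fixes f :: "'a::euclidean_space \<Rightarrow> real"
  assumes "C1_on S f" "\<And>x. x \<in> S \<Longrightarrow> f x \<noteq> 0"
  shows "C1_on S (\<lambda>x. inverse (f x))"
proof (rule C1_on_real_compose[OF assms(1)])
  show "(inverse has_real_derivative - (inverse y ^ Suc (Suc 0))) (at y)" if "y \<in> - {0}" for y :: real
    using that by (intro DERIV_inverse) auto
qed (use assms(2) in \<open>auto intro!: continuous_intros\<close>)

lemma C1_on_divide:
  fixes f g :: "'a::euclidean_space \<Rightarrow> real"
  assumes "C1_on S f" "C1_on S g" "\<And>x. x \<in> S \<Longrightarrow> g x \<noteq> 0"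
  shows "C1_on S (\<lambda>x. f x / g x)"
  unfolding divide_inverse using assms by (intro C1_on_mult C1_on_inverse)

lemma C1_on_norm:
  fixes f :: "'a::euclidean_space \<Rightarrow> 'b::euclidean_space"
  assumes "C1_on S f" "\<And>x. x \<in> S \<Longrightarrow> f x \<noteq> 0"
  shows "C1_on S (\<lambda>x. norm (f x))"
  unfolding norm_eq_sqrt_inner
proof (rule C1_on_real_compose[of S "\<lambda>x. f x \<bullet> f x" "{0<..}" sqrt "\<lambda>y. inverse (sqrt y) / 2"])
  show "C1_on S (\<lambda>x. f x \<bullet> f x)"
    using assms(1) by (intro C1_on_inner)
  show "(sqrt has_real_derivative inverse (sqrt y) / 2) (at y)" if "y \<in> {0<..}" for y
    using that by (intro DERIV_real_sqrt) auto
qed (use assms(2) in \<open>auto intro!: continuous_intros\<close>)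

text \<open>\<open>C1_on\<close> asks for an extension to negative times, whereas the derivative at
  0 is one-sided. The tangent line at 0 matches both value and derivative there.\<close>

lemma C1_on_halfline:
  fixes f :: "real \<Rightarrow> 'b::real_normed_vector"
  assumes d: "\<And>t. t \<ge> 0 \<Longrightarrow> (f has_vector_derivative f' t) (at t within {0..})"
    and c: "continuous_on {0..} f'"
  shows "C1_on {0..} f"
proof -
  let ?F = "\<lambda>t. if t \<in> {0..} then f t else f 0 + t *\<^sub>R f' 0"
  let ?F' = "\<lambda>t. if t \<in> {0..} then f' t else f' 0"
  have "(?F has_vector_derivative ?F' t) (at t within UNIV)" for t :: real
  proof (rule has_vector_derivative_If_within_closures[where T = "{..0}"])
    show "((\<lambda>t. f 0 + t *\<^sub>R f' 0) has_vector_derivative f' 0)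
        (at t within {..0} \<union> closure {0..} \<inter> closure {..0})"
      by (rule derivative_eq_intros | simp)+
    have "{0..} \<union> {0..} \<inter> {..0} = {0::real..}" by auto
    then show "(f has_vector_derivative f' t) (at t within {0..} \<union> closure {0..} \<inter> closure {..0})"
      if "t \<in> {0..} \<union> closure {0..} \<inter> closure {..0}"
      using that d[of t] by simp
  qed auto
  then have "(?F has_derivative (\<lambda>h. h *\<^sub>R ?F' t)) (at t)" for t :: real
    unfolding has_vector_derivative_def by blast
  moreover have "continuous_on UNIV ?F'"
  proof -
    have "continuous_on UNIV (\<lambda>t. f' (max 0 t))"
      by (rule continuous_on_compose2[OF c]) (auto intro!: continuous_intros)
    then show ?thesis
      by (rule continuous_on_eq) (auto simp: max_def)
  qed
  ultimately have "C1_on UNIV ?F"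
    by (intro C1_on_openI[where f' = "\<lambda>t h. h *\<^sub>R ?F' t"] continuous_intros) auto
  then have "C1_on {0..} ?F"
    by (rule C1_on_subset) simp
  then show ?thesis
    by (subst C1_on_cong[where g = ?F]) auto
qed

text \<open>Made for integrands that are C1 in \<open>x\<close> but only continuous in time: time
  enters through the path \<open>p\<close> alone. The integration itself supplies differentiability
  in \<open>t\<close>, so the result is jointly C1.\<close>

lemma C1_on_integral_param:
  fixes \<Psi> :: "'p::euclidean_space \<times> 'a::euclidean_space \<Rightarrow> real"
    and p :: "real \<Rightarrow> 'p"
  assumes Z: "open Z" "C1_on Z \<Psi>" and W: "open W" and p: "continuous_on {0..} p"
    and sub: "\<And>\<tau> x. \<tau> \<ge> 0 \<Longrightarrow> x \<in> W \<Longrightarrow> (p \<tau>, x) \<in> Z"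
  shows "C1_on ({0..} \<times> W) (\<lambda>(t, x). integral {0..t} (\<lambda>\<tau>. \<Psi> (p \<tau>, x)))"
proof -
  obtain \<Psi>' where \<Psi>': "\<And>z. z \<in> Z \<Longrightarrow> (\<Psi> has_derivative blinfun_apply (\<Psi>' z)) (at z)" "continuous_on Z \<Psi>'"
    using C1_on_openE[OF Z(2,1)] by blast
  \<comment> \<open>Frozen at \<open>p 0\<close> for negative times, so that derivatives can be
    taken on the open set \<open>UNIV \<times> W\<close>.\<close>
  define P where "P \<tau> = p (max 0 \<tau>)" for \<tau> :: real
  have cP: "continuous_on A P" for A
    unfolding P_def by (rule continuous_on_compose2[OF p]) (auto intro!: continuous_intros)
  have PZ: "(P \<tau>, x) \<in> Z" if "x \<in> W" for \<tau> x
    unfolding P_def using sub that by simp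
  have c\<Psi>: "continuous_on Z \<Psi>"
    using Z(2) by (rule C1_on_continuous_on)
  define f where "f \<tau> x = \<Psi> (P \<tau>, x)" for \<tau> x
  define f' where "f' \<tau> x = \<Psi>' (P \<tau>, x) o\<^sub>L Blinfun (Pair 0)" for \<tau> x
  have bl0: "bounded_linear (Pair (0::'p) :: 'a \<Rightarrow> 'p \<times> 'a)"
    by (intro bounded_linear_Pair bounded_linear_zero bounded_linear_ident)
  have f': "((\<lambda>x. f \<tau> x) has_derivative blinfun_apply (f' \<tau> x)) (at x)" if "x \<in> W" for \<tau> x
  proof -
    have "((\<lambda>x. \<Psi> (P \<tau>, x)) has_derivative (\<lambda>h. \<Psi>' (P \<tau>, x) (0, h))) (at x)"
      by (rule has_derivative_compose[of "\<lambda>x. (P \<tau>, x)" _ x UNIV, OF _ \<Psi>'(1)[OF PZ[OF that]]])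
        (auto intro!: derivative_eq_intros)
    moreover have "blinfun_apply (f' \<tau> x) = (\<lambda>h. \<Psi>' (P \<tau>, x) (0, h))"
      by (rule ext) (simp add: f'_def bounded_linear_Blinfun_apply[OF bl0])
    ultimately show ?thesis
      by (simp add: f_def)
  qed
  have cf: "continuous_on A (\<lambda>y. f (a y) (b y))"
    if "continuous_on A a" "continuous_on A b" "\<And>y. y \<in> A \<Longrightarrow> b y \<in> W" for A :: "'q::topological_space set" and a b
    unfolding f_def using that PZ
    by (intro continuous_on_compose2[OF c\<Psi>] continuous_intros continuous_on_compose2[OF cP[of UNIV] that(1)]) auto
  have cf': "continuous_on A (\<lambda>y. f' (a y) (b y))"
    if "continuous_on A a" "continuous_on A b" "\<And>y. y \<in> A \<Longrightarrow> b y \<in> W" for A :: "'q::topological_space set" and a b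
    unfolding f'_def using that PZ
    by (intro continuous_on_compose2[OF \<Psi>'(2)] continuous_intros continuous_on_compose2[OF cP[of UNIV] that(1)]) auto
  \<comment> \<open>Rescaling to [0, 1] frees the domain of integration from \<open>t\<close>, as
    differentiation in \<open>x\<close> under the integral requires, and continues the function to
    negative \<open>t\<close>, where \<open>integral {0..t}\<close> would be 0.\<close>
  define F where "F t x = t *\<^sub>R integral {0..1} (\<lambda>\<sigma>. f (t * \<sigma>) x)" for t :: real and x
  define F' where "F' t x = t *\<^sub>R integral (cbox 0 1) (\<lambda>\<sigma>. f' (t * \<sigma>) x)" for t :: real and x
  \<comment> \<open>The primitive starts at \<open>-N\<close>, left of both 0 and \<open>t\<close>,
    so that one formula covers both signs of \<open>t\<close> and the fundamental theorem of
    calculus gives the derivative in \<open>t\<close>.\<close>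
  have F_eq: "F t x = integral {-N..t} (\<lambda>\<tau>. f \<tau> x) - integral {-N..0} (\<lambda>\<tau>. f \<tau> x)"
    if x: "x \<in> W" and t: "t \<in> {-N..N}" for t N x
  proof -
    let ?G = "\<lambda>t. integral {-N..t} (\<lambda>\<tau>. f \<tau> x)"
    have G: "(?G has_vector_derivative f s x) (at s within {-N..N})" if "s \<in> {-N..N}" for s
      by (rule integral_has_vector_derivative) (use x that in \<open>auto intro!: cf continuous_intros\<close>)
    have in_N: "t * \<sigma> \<in> {-N..N}" if "\<sigma> \<in> {0..1}" for \<sigma>
    proof -
      have "\<bar>t * \<sigma>\<bar> \<le> N * 1"
        unfolding abs_mult using t that by (intro mult_mono) auto
      then show ?thesis by (simp add: abs_le_iff)
    qed
    have "((\<lambda>\<sigma>. t *\<^sub>R f (t * \<sigma>) x) has_integral ?G (t * 1) - ?G (t * 0)) {0..1}"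
    proof (rule fundamental_theorem_of_calculus)
      fix \<sigma> :: real assume \<sigma>: "\<sigma> \<in> {0..1}"
      have "((\<lambda>\<sigma>. t * \<sigma>) has_vector_derivative t) (at \<sigma> within {0..1})"
        by (auto intro!: derivative_eq_intros)
      moreover have "(?G has_vector_derivative f (t * \<sigma>) x) (at (t * \<sigma>) within (\<lambda>\<sigma>. t * \<sigma>) ` {0..1})"
        by (rule has_vector_derivative_within_subset[OF G[OF in_N[OF \<sigma>]]]) (use in_N in auto)
      ultimately show "((\<lambda>\<sigma>. ?G (t * \<sigma>)) has_vector_derivative t *\<^sub>R f (t * \<sigma>) x) (at \<sigma> within {0..1})"
        using vector_diff_chain_within[of "\<lambda>\<sigma>. t * \<sigma>" t \<sigma> "{0..1}" ?G] by (simp add: o_def)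
    qed simp
    from integral_unique[OF this] show ?thesis
      by (simp add: F_def)
  qed
  have F_pos: "F t x = integral {0..t} (\<lambda>\<tau>. \<Psi> (p \<tau>, x))" if "t \<ge> 0" "x \<in> W" for t x
  proof -
    have "integral {-t..0} (\<lambda>\<tau>. f \<tau> x) + integral {0..t} (\<lambda>\<tau>. f \<tau> x) = integral {-t..t} (\<lambda>\<tau>. f \<tau> x)"
      by (rule Henstock_Kurzweil_Integration.integral_combine)
        (use that in \<open>auto intro!: integrable_continuous_interval cf continuous_intros\<close>)
    moreover have "integral {0..t} (\<lambda>\<tau>. f \<tau> x) = integral {0..t} (\<lambda>\<tau>. \<Psi> (p \<tau>, x))"
      by (rule Henstock_Kurzweil_Integration.integral_cong) (simp add: f_def P_def)
    ultimately show ?thesis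
      using F_eq[of x t t] that by simp
  qed
  have F_t: "((\<lambda>t. F t x) has_derivative (\<lambda>h. h *\<^sub>R f t x)) (at t)" if x: "x \<in> W" for t x
  proof -
    define N where "N = \<bar>t\<bar> + 1"
    have t: "t \<in> {-N<..<N}" by (auto simp: N_def)
    let ?G = "\<lambda>t. integral {-N..t} (\<lambda>\<tau>. f \<tau> x)"
    have "(?G has_vector_derivative f t x) (at t within {-N..N})"
      by (rule integral_has_vector_derivative) (use x t in \<open>auto intro!: cf continuous_intros\<close>)
    then have "(?G has_vector_derivative f t x) (at t within {-N<..<N})"
      by (rule has_vector_derivative_within_subset) (rule greaterThanLessThan_subseteq_atLeastAtMost_iff[THEN iffD2], simp)
    then have "(?G has_vector_derivative f t x) (at t)"
      unfolding at_within_open[OF t open_greaterThanLessThan] .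
    then have "((\<lambda>t. ?G t - ?G 0) has_derivative (\<lambda>h. h *\<^sub>R f t x)) (at t)"
      unfolding has_vector_derivative_def by (auto intro!: derivative_eq_intros)
    then show ?thesis
      by (rule has_derivative_transform_within_open[OF _ open_greaterThanLessThan t]) (rule F_eq[OF x, symmetric], simp)
  qed
  have F_x: "((\<lambda>x. F t x) has_derivative blinfun_apply (F' t x)) (at x within Y)"
    if "x \<in> Y" "Y \<subseteq> W" "convex Y" for t x Y
  proof -
    have "((\<lambda>x. integral (cbox 0 1) (\<lambda>\<sigma>. f (t * \<sigma>) x)) has_derivative
        blinfun_apply (integral (cbox 0 1) (\<lambda>\<sigma>. f' (t * \<sigma>) x))) (at x within Y)"
    proof (rule leibniz_rule[where f = "\<lambda>x \<sigma>. f (t * \<sigma>) x" and fx = "\<lambda>x \<sigma>. f' (t * \<sigma>) x"])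
      show "((\<lambda>x. f (t * \<sigma>) x) has_derivative blinfun_apply (f' (t * \<sigma>) x)) (at x within Y)"
        if "x \<in> Y" for x \<sigma>
        by (rule has_derivative_at_withinI[OF f']) (use that \<open>Y \<subseteq> W\<close> in blast)
      show "(\<lambda>\<sigma>. f (t * \<sigma>) x) integrable_on cbox 0 1" if "x \<in> Y" for x
        by (rule integrable_continuous) (use that \<open>Y \<subseteq> W\<close> in \<open>auto intro!: cf continuous_intros\<close>)
      show "continuous_on (Y \<times> cbox 0 1) (\<lambda>(x, \<sigma>). f' (t * \<sigma>) x)"
        unfolding case_prod_beta by (rule cf') (use that in \<open>auto intro!: continuous_intros\<close>)
    qed (use that in auto)
    then have "((\<lambda>x. t *\<^sub>R integral (cbox 0 1) (\<lambda>\<sigma>. f (t * \<sigma>) x)) has_derivative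
        (\<lambda>h. t *\<^sub>R blinfun_apply (integral (cbox 0 1) (\<lambda>\<sigma>. f' (t * \<sigma>) x)) h)) (at x within Y)"
      by (rule has_derivative_scaleR_right)
    then show ?thesis
      by (simp add: F_def F'_def scaleR_blinfun.rep_eq)
  qed
  have cF': "continuous_on (UNIV \<times> W) (\<lambda>(t, x). F' t x)"
  proof -
    have "continuous_on (UNIV \<times> W) (\<lambda>z. integral (cbox 0 1) (\<lambda>\<sigma>. f' (fst z * \<sigma>) (snd z)))"
      by (rule integral_continuous_on_param, unfold case_prod_beta, rule cf')
        (auto intro!: continuous_intros)
    then show ?thesis
      unfolding F'_def case_prod_beta by (intro continuous_intros)
  qed
  have oW: "open (UNIV \<times> W)"
    using W by (simp add: open_Times)
  have "C1_on (UNIV \<times> W) (\<lambda>(t, x). F t x)"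
  proof (rule C1_on_openI[OF oW])
    fix z assume z: "z \<in> (UNIV::real set) \<times> W"
    obtain e where e: "e > 0" "ball (snd z) e \<subseteq> W"
      using W z openE by (metis mem_Times_iff)
    have D: "((\<lambda>(t, x). F t x) has_derivative (\<lambda>(th, xh). th *\<^sub>R f (fst z) (snd z) + F' (fst z) (snd z) xh))
        (at (fst z, snd z) within UNIV \<times> ball (snd z) e)"
    \<comment> \<open>The partial derivative in \<open>t\<close> is needed at the point only; the
      one in \<open>x\<close> must exist on a convex set and be jointly continuous at the point,
      hence the ball.\<close>
    proof (rule has_derivative_partialsI)
      show "((\<lambda>t. F t (snd z)) has_derivative (\<lambda>h. h *\<^sub>R f (fst z) (snd z))) (at (fst z) within UNIV)"
        by (rule F_t) (use z in auto)
      show "((\<lambda>y. F x y) has_derivative blinfun_apply (F' x y)) (at y within ball (snd z) e)"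
        if "y \<in> ball (snd z) e" for x y
        by (rule F_x) (use that e in auto)
      have "continuous (at z) (\<lambda>(t, x). F' t x)"
        using continuous_on_eq_continuous_at[OF oW] cF' z by blast
      then show "continuous (at (fst z, snd z) within UNIV \<times> ball (snd z) e) (\<lambda>(x, y). F' x y)"
        by (simp add: continuous_at_imp_continuous_at_within)
    qed (use e in auto)
    have zB: "z \<in> UNIV \<times> ball (snd z) e" "open ((UNIV::real set) \<times> ball (snd z) e)"
      using e by (auto simp: mem_Times_iff open_Times)
    have at_z: "at (fst z, snd z) within UNIV \<times> ball (snd z) e = at z"
      unfolding prod.collapse by (rule at_within_open[OF zB])
    have D_eq: "(\<lambda>(th, xh). th *\<^sub>R f (fst z) (snd z) + F' (fst z) (snd z) xh) =
        (\<lambda>h. fst h *\<^sub>R f (fst z) (snd z) + F' (fst z) (snd z) (snd h))"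
      by (rule ext) (simp only: case_prod_beta)
    show "((\<lambda>(t, x). F t x) has_derivative
        (\<lambda>h. fst h *\<^sub>R f (fst z) (snd z) + F' (fst z) (snd z) (snd h))) (at z)"
      using D unfolding at_z D_eq .
  next
    show "continuous_on (UNIV \<times> W) (\<lambda>z. fst h *\<^sub>R f (fst z) (snd z) + F' (fst z) (snd z) (snd h))" for h
      using cF' by (intro continuous_intros cf) (auto simp: case_prod_beta intro!: continuous_intros)
  qed
  then have "C1_on ({0..} \<times> W) (\<lambda>(t, x). F t x)"
    by (rule C1_on_subset) auto
  then show ?thesis
    by (subst C1_on_cong[where g = "\<lambda>(t, x). F t x"]) (auto simp: F_pos)
qed

subsection \<open>Radial functions of convex domains\<close>

text \<open>This is the inverse function theorem for \<open>H (x, y) = (x, f (x, y))\<close>: the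
  solution is the second component of the inverse at \<open>(x, 0)\<close>.\<close>

lemma implicit_function_real:
  fixes f :: "'a::euclidean_space \<times> real \<Rightarrow> real"
  assumes U: "open U" and f: "C1_on U f"
    and z0: "(x0, y0) \<in> U" "f (x0, y0) = 0"
    and D: "(f has_derivative D) (at (x0, y0))" "D (0, 1) \<noteq> 0"
  shows "\<exists>W g. open W \<and> x0 \<in> W \<and> g x0 = y0 \<and> C1_on W g \<and> (\<forall>x\<in>W. (x, g x) \<in> U \<and> f (x, g x) = 0)"
proof -
  obtain f' where f': "\<And>z. z \<in> U \<Longrightarrow> (f has_derivative blinfun_apply (f' z)) (at z)" "continuous_on U f'"
    using C1_on_openE[OF f U] by blast
  define a where "a = f' (x0, y0) (0, 1)"
  have "a \<noteq> 0"
    using has_derivative_unique[OF f'(1)[OF z0(1)] D(1)] D(2) by (simp add: a_def)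
  define H where "H z = (fst z, f z)" for z
  define H' where "H' z = Blinfun (\<lambda>h. (fst h, f' z h))" for z
  have H'_apply: "H' z h = (fst h, f' z h)" for z h
  proof -
    have "bounded_linear (\<lambda>h. (fst h, f' z h))"
      by (intro bounded_linear_Pair bounded_linear_fst blinfun.bounded_linear_right)
    then show ?thesis
      by (simp add: H'_def bounded_linear_Blinfun_apply)
  qed
  \<comment> \<open>The inverse of the derivative of \<open>H\<close> at the base point, found by
    solving a linear equation for the last coordinate; \<open>a\<close> is the partial derivative by
    which one divides.\<close>
  define K where "K = Blinfun (\<lambda>h. (fst h, (snd h - f' (x0, y0) (fst h, 0)) / a))"
  have K_apply: "K h = (fst h, (snd h - f' (x0, y0) (fst h, 0)) / a)" for h
  proof -
    have "bounded_linear (\<lambda>h. (fst h, (snd h - f' (x0, y0) (fst h, 0)) / a))"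
      unfolding divide_inverse
      by (intro bounded_linear_Pair bounded_linear_fst bounded_linear_mult_const bounded_linear_sub
          bounded_linear_snd blinfun.bounded_linear_right bounded_linear_compose[OF blinfun.bounded_linear_right]
          bounded_linear_zero)
    then show ?thesis
      by (simp add: K_def bounded_linear_Blinfun_apply)
  qed
  have split: "f' z h = f' z (fst h, 0) + snd h * f' z (0, 1)" for z h
  proof -
    have "h = (fst h, 0) + snd h *\<^sub>R (0, 1)"
      by (simp add: prod_eq_iff)
    then have "f' z h = f' z ((fst h, 0) + snd h *\<^sub>R (0, 1))"
      by simp
    also have "\<dots> = f' z (fst h, 0) + snd h * f' z (0, 1)"
      by (simp only: blinfun.add_right blinfun.scaleR_right real_scaleR_def)
    finally show ?thesis .
  qed
  have "K o\<^sub>L H' (x0, y0) = id_blinfun"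
  proof (rule blinfun_eqI)
    fix h
    have "f' (x0, y0) h - f' (x0, y0) (fst h, 0) = snd h * a"
      using split[of "(x0, y0)" h] by (simp add: a_def)
    with \<open>a \<noteq> 0\<close> show "(K o\<^sub>L H' (x0, y0)) h = id_blinfun h"
      by (simp add: K_apply H'_apply prod_eq_iff)
  qed
  moreover have "(H has_derivative blinfun_apply (H' z)) (at z)" if "z \<in> U" for z
  proof -
    have "(H has_derivative (\<lambda>h. (fst h, f' z h))) (at z)"
      unfolding H_def by (intro has_derivative_Pair f'(1) that has_derivative_fst has_derivative_ident)
    then show ?thesis
      by (simp add: H'_apply[abs_def])
  qed
  moreover have "continuous_on U H'"
    by (rule continuous_on_blinfun_componentwise) (auto simp: H'_apply intro!: continuous_intros f'(2))
  ultimately obtain U' V G G' where U': "open U'" "U' \<subseteq> U" "(x0, y0) \<in> U'"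
    and V: "open V" "H (x0, y0) \<in> V" and hom: "homeomorphism U' V H G"
    and G: "\<And>y. y \<in> V \<Longrightarrow> (G has_derivative G' y) (at y)"
    "\<And>y. y \<in> V \<Longrightarrow> G' y = inv (blinfun_apply (H' (G y)))"
    "\<And>y. y \<in> V \<Longrightarrow> bij (blinfun_apply (H' (G y)))"
    using inverse_function_theorem[OF U _ _ z0(1), of H H' K] by blast
  define W where "W = (\<lambda>x. (x, 0)) -` V"
  define g where "g x = snd (G (x, 0))" for x
  have oW: "open W"
    unfolding W_def using V(1) by (intro open_vimage continuous_intros)
  have G_g: "G (x, 0) = (x, g x) \<and> (x, g x) \<in> U \<and> f (x, g x) = 0" if "x \<in> W" for x
  proof -
    have "(x, 0) \<in> V" using that by (simp add: W_def)
    then have "H (G (x, 0)) = (x, 0)" "G (x, 0) \<in> U"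
      using hom U'(2) unfolding homeomorphism_def by auto
    moreover from this have "G (x, 0) = (x, g x)"
      by (simp add: H_def g_def prod_eq_iff)
    ultimately show ?thesis
      by (simp add: H_def)
  qed
  have H0: "H (x0, y0) = (x0, 0)"
    using z0 by (simp add: H_def)
  have x0: "x0 \<in> W"
    using V(2) H0 by (simp add: W_def)
  have g0: "g x0 = y0"
  proof -
    have "G (H (x0, y0)) = (x0, y0)"
      using hom U'(3) unfolding homeomorphism_def by auto
    then show ?thesis
      by (simp add: g_def H0)
  qed
  \<comment> \<open>Implicit differentiation of \<open>f (x, g x) = 0\<close>. As an explicit
    quotient it is visibly continuous in \<open>x\<close>.\<close>
  define g' where "g' x h = - f' (x, g x) (h, 0) / f' (x, g x) (0, 1)" for x h
  \<comment> \<open>The denominator cannot vanish near the base point either: \<open>H'\<close> is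
    bijective there, which rules out the kernel vector \<open>(0, 1)\<close>.\<close>
  have nz: "f' (x, g x) (0, 1) \<noteq> 0" if "x \<in> W" for x
  proof
    assume "f' (x, g x) (0, 1) = 0"
    then have "H' (G (x, 0)) (0, 1) = H' (G (x, 0)) 0"
      using G_g[OF that] by (simp add: H'_apply blinfun.zero_right flip: zero_prod_def)
    moreover have "inj (blinfun_apply (H' (G (x, 0))))"
      using G(3)[of "(x, 0)"] that by (simp add: W_def bij_is_inj)
    ultimately have "(0, 1) = (0 :: 'a \<times> real)"
      by (rule injD[rotated])
    then show False
      by (simp add: prod_eq_iff)
  qed
  have g_deriv: "(g has_derivative g' x) (at x)" if "x \<in> W" for x
  proof -
    have xV: "(x, 0) \<in> V" using that by (simp add: W_def)
    have "((\<lambda>x. G (x, 0)) has_derivative (\<lambda>h. G' (x, 0) (h, 0))) (at x)"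
      by (rule has_derivative_compose[of "\<lambda>x. (x, 0)" _ x UNIV, OF _ G(1)[OF xV]])
        (auto intro!: derivative_eq_intros)
    then have "(g has_derivative (\<lambda>h. snd (G' (x, 0) (h, 0)))) (at x)"
      unfolding g_def by (rule has_derivative_snd)
    moreover have "snd (G' (x, 0) (h, 0)) = g' x h" for h
    proof -
      let ?w = "G' (x, 0) (h, 0)"
      have "H' (G (x, 0)) ?w = (h, 0)"
        unfolding G(2)[OF xV] by (rule surj_f_inv_f) (use G(3)[OF xV] bij_is_surj in blast)
      then have "fst ?w = h" "f' (x, g x) ?w = 0"
        using G_g[OF that] by (auto simp: H'_apply)
      then show ?thesis
        using split[of "(x, g x)" ?w] nz[OF that] by (simp add: g'_def field_simps eq_neg_iff_add_eq_0)
    qed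
    ultimately show ?thesis
      by simp
  qed
  have "C1_on W g"
  proof (rule C1_on_openI[OF oW g_deriv])
    have cg: "continuous_on W g"
      by (intro continuous_at_imp_continuous_on ballI) (rule has_derivative_continuous[OF g_deriv])
    have "continuous_on W (\<lambda>x. f' (x, g x))"
      by (rule continuous_on_compose2[OF f'(2)]) (use G_g in \<open>auto intro!: continuous_intros cg\<close>)
    then show "continuous_on W (\<lambda>x. g' x h)" for h
      unfolding g'_def by (intro continuous_intros) (use nz in auto)
  qed
  with oW x0 g0 G_g show ?thesis
    by (intro exI[of _ W] exI[of _ g] conjI ballI) simp_all
qed

text \<open>The vector \<open>u\<close> is not normalised, so that the pairs \<open>(c, u)\<close>
  range over an open set, as the implicit function theorem wants.\<close>

definition radial :: "'a::real_vector set \<Rightarrow> 'a \<Rightarrow> 'a \<Rightarrow> real" where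
  "radial S c u = (THE l. 0 < l \<and> c + l *\<^sub>R u \<in> S)"

text \<open>The nearer of two such points would lie on an open segment from an interior point to a
  point of the closure, hence in the interior.\<close>

lemma ray_frontier_inj:
  fixes c :: "'a::euclidean_space"
  assumes "open \<Omega>" "convex \<Omega>" "c \<in> \<Omega>"
    and "0 < l" "c + l *\<^sub>R u \<in> frontier \<Omega>" "0 < m" "c + m *\<^sub>R u \<in> frontier \<Omega>"
  shows "l = m"
proof -
  have *: False if "0 < l" "l < m" "c + l *\<^sub>R u \<in> frontier \<Omega>" "c + m *\<^sub>R u \<in> frontier \<Omega>" for l m
  proof -
    have ne: "c \<noteq> c + m *\<^sub>R u"
      using that assms(1,3) by (auto simp: frontier_def interior_open)
    have "open_segment c (c + m *\<^sub>R u) \<subseteq> interior \<Omega>"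
      by (rule in_interior_closure_convex_segment)
        (use that assms(1-3) in \<open>auto simp: frontier_def interior_open\<close>)
    moreover have "c + l *\<^sub>R u \<in> open_segment c (c + m *\<^sub>R u)"
      unfolding in_segment using that ne
      by (intro conjI exI[of _ "l / m"]) (auto simp: algebra_simps)
    ultimately show False
      using that by (auto simp: frontier_def)
  qed
  show ?thesis
    using *[of l m] *[of m l] assms by (cases l m rule: linorder_cases) auto
qed

lemma radial_eqI:
  fixes c :: "'a::euclidean_space"
  assumes "open \<Omega>" "convex \<Omega>" "c \<in> \<Omega>" "0 < l" "c + l *\<^sub>R u \<in> frontier \<Omega>"
  shows "radial (frontier \<Omega>) c u = l"
  unfolding radial_def
  by (rule the_equality) (use assms ray_frontier_inj[of \<Omega> c] in blast)+

lemma radial_frontier: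
  fixes c :: "'a::euclidean_space"
  assumes "open \<Omega>" "convex \<Omega>" "bounded \<Omega>" "c \<in> \<Omega>" "u \<noteq> 0"
  shows "0 < radial (frontier \<Omega>) c u" "c + radial (frontier \<Omega>) c u *\<^sub>R u \<in> frontier \<Omega>"
proof -
  obtain d where "0 < d" "c + d *\<^sub>R u \<in> frontier \<Omega>"
    using ray_to_frontier[of \<Omega> c u] assms by (auto simp: interior_open)
  moreover from this have "radial (frontier \<Omega>) c u = d"
    using radial_eqI assms by blast
  ultimately show "0 < radial (frontier \<Omega>) c u" "c + radial (frontier \<Omega>) c u *\<^sub>R u \<in> frontier \<Omega>"
    by simp_all
qed

text \<open>
  If the normal were orthogonal to the ray, \<open>F\<close> would change sign between two points close to
  \<open>M\<close> on either side of the segment from \<open>M\<close> to \<open>c\<close>, inside the cone joining \<open>M\<close> to a ball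
  around \<open>c\<close>; but this cone lies in the interior, where \<open>F\<close> has no zero.
\<close>

lemma convex_frontier_transversal:
  fixes c :: "'a::euclidean_space"
  assumes \<Omega>: "open \<Omega>" "convex \<Omega>" and c: "c \<in> \<Omega>" and U: "open U" "M \<in> U"
    and F: "\<And>x. x \<in> U \<Longrightarrow> isCont F x" "(F has_derivative (\<lambda>h. n \<bullet> h)) (at M)" "n \<noteq> 0"
    and zero: "frontier \<Omega> \<inter> U = {x \<in> U. F x = (0::real)}" and M: "M \<in> frontier \<Omega>"
  shows "n \<bullet> (M - c) \<noteq> 0"
proof
  assume orth: "n \<bullet> (M - c) = 0"
  obtain e where e: "e > 0" "ball c e \<subseteq> \<Omega>"
    using \<Omega>(1) c openE by blast
  \<comment> \<open>Chosen so that \<open>c + b *\<^sub>R n\<close> stays within distance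
    \<open>e / 2\<close> of \<open>c\<close> whenever \<open>\<bar>b\<bar> \<le> r\<close>.\<close>
  define r where "r = e / (2 * norm n)"
  have r: "r > 0" using e F(3) by (simp add: r_def)
  have inside: "M + s *\<^sub>R (c + b *\<^sub>R n - M) \<in> \<Omega>" if s: "0 < s" "s < 1" and b: "\<bar>b\<bar> \<le> r" for s b
  proof -
    have "\<bar>b\<bar> * norm n \<le> r * norm n"
      using b by (intro mult_right_mono) auto
    also have "\<dots> < e"
      using e F(3) by (simp add: r_def)
    finally have cb: "c + b *\<^sub>R n \<in> interior \<Omega>"
      using e \<Omega>(1) by (auto simp: interior_open dist_norm subset_iff)
    moreover have "M \<in> closure \<Omega>"
      using M by (simp add: frontier_def)
    ultimately have "open_segment (c + b *\<^sub>R n) M \<subseteq> \<Omega>"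
      using in_interior_closure_convex_segment[OF \<Omega>(2)] \<Omega>(1) by (metis interior_open)
    moreover have "c + b *\<^sub>R n \<noteq> M"
      using cb M by (auto simp: frontier_def)
    then have "M + s *\<^sub>R (c + b *\<^sub>R n - M) \<in> open_segment (c + b *\<^sub>R n) M"
      unfolding in_segment using s by (intro conjI exI[of _ "1 - s"]) (auto simp: algebra_simps)
    ultimately show ?thesis ..
  qed
  have F_M: "F M = 0"
    using zero M U by auto
  have nn: "n \<bullet> n > 0" using F(3) by simp
  \<comment> \<open>As \<open>n\<close> is orthogonal to \<open>M - c\<close>, only the component
    \<open>b *\<^sub>R n\<close> of the direction counts to first order. So for
    \<open>b \<noteq> 0\<close> the function \<open>F\<close> takes the sign of \<open>b\<close>
    close to \<open>M\<close>.\<close>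
  have sgn: "((\<lambda>s. F (M + s *\<^sub>R (c + b *\<^sub>R n - M)) / s) \<longlongrightarrow> b * (n \<bullet> n)) (at_right 0)" for b
  proof -
    have "((\<lambda>s. F (M + s *\<^sub>R (c + b *\<^sub>R n - M))) has_derivative (\<lambda>s. n \<bullet> (s *\<^sub>R (c + b *\<^sub>R n - M)))) (at 0)"
      by (rule has_derivative_compose[of "\<lambda>s. M + s *\<^sub>R (c + b *\<^sub>R n - M)" _ 0 UNIV])
        (auto intro!: derivative_eq_intros F(2))
    moreover have "n \<bullet> (c + b *\<^sub>R n - M) = b * (n \<bullet> n)"
      using orth by (simp add: inner_simps)
    ultimately have "((\<lambda>s. F (M + s *\<^sub>R (c + b *\<^sub>R n - M))) has_real_derivative b * (n \<bullet> n)) (at 0)"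
      by (simp add: has_field_derivative_def mult_commute_abs)
    then have "((\<lambda>s. F (M + s *\<^sub>R (c + b *\<^sub>R n - M)) / s) \<longlongrightarrow> b * (n \<bullet> n)) (at 0)"
      by (simp add: DERIV_def F_M)
    then show ?thesis
      by (rule tendsto_mono[rotated]) (simp add: at_le)
  qed
  obtain d where d: "d > 0" "ball M d \<subseteq> U"
    using U openE by blast
  \<comment> \<open>Bounds \<open>norm (c + b *\<^sub>R n - M)\<close> for all admissible
    \<open>b\<close>, so that steps \<open>s\<close> below \<open>d / K\<close> stay in
    \<open>U\<close>; the summand 1 makes it positive.\<close>
  define K where "K = norm (c - M) + r * norm n + 1"
  have K: "K > 0" using r by (simp add: K_def add_nonneg_pos)
  have "eventually (\<lambda>s. F (M + s *\<^sub>R (c + r *\<^sub>R n - M)) / s > 0) (at_right 0)"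
    using order_tendstoD(1)[OF sgn[of r]] r nn by simp
  moreover have "eventually (\<lambda>s. F (M + s *\<^sub>R (c + (- r) *\<^sub>R n - M)) / s < 0) (at_right 0)"
    using order_tendstoD(2)[OF sgn[of "- r"]] r nn by simp
  moreover have "eventually (\<lambda>s. s \<in> {0<..<min 1 (d / K)}) (at_right 0)"
    using d K by (intro eventually_at_right_field[THEN iffD2] exI[of _ "min 1 (d / K)"]) auto
  ultimately have "eventually (\<lambda>s. F (M + s *\<^sub>R (c + r *\<^sub>R n - M)) / s > 0 \<and>
      F (M + s *\<^sub>R (c + (- r) *\<^sub>R n - M)) / s < 0 \<and> s \<in> {0<..<min 1 (d / K)}) (at_right 0)"
    by (intro eventually_conj)
  then obtain s where s: "F (M + s *\<^sub>R (c + r *\<^sub>R n - M)) / s > 0"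
      "F (M + s *\<^sub>R (c + (- r) *\<^sub>R n - M)) / s < 0" "s \<in> {0<..<min 1 (d / K)}"
    using eventually_happens[of _ "at_right (0::real)"] trivial_limit_at_right_real by blast
  have s1: "0 < s" "s < 1" "s * K < d"
    using s(3) K by (auto simp: pos_less_divide_eq)
  have in_U: "M + s *\<^sub>R (c + b *\<^sub>R n - M) \<in> U" if "b \<in> {-r..r}" for b
  proof -
    have "norm (c + b *\<^sub>R n - M) = norm ((c - M) + b *\<^sub>R n)"
      by (simp add: algebra_simps)
    also have "\<dots> \<le> norm (c - M) + \<bar>b\<bar> * norm n"
      by (metis norm_scaleR norm_triangle_ineq)
    also have "\<dots> \<le> K"
      using that mult_right_mono[of "\<bar>b\<bar>" r "norm n"] by (simp add: K_def abs_le_iff)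
    finally have "s * norm (c + b *\<^sub>R n - M) \<le> s * K"
      using s1 by (intro mult_left_mono) auto
    with s1(3) have "s * norm (c + b *\<^sub>R n - M) < d"
      by linarith
    then have "M + s *\<^sub>R (c + b *\<^sub>R n - M) \<in> ball M d"
      using s1 by (simp add: dist_norm)
    then show ?thesis
      using d by blast
  qed
  let ?h = "\<lambda>b. F (M + s *\<^sub>R (c + b *\<^sub>R n - M))"
  have "continuous_on {-r..r} ?h"
  proof (rule continuous_on_compose2[of U F])
    show "continuous_on U F"
      using F(1) by (simp add: continuous_at_imp_continuous_on)
  qed (use in_U in \<open>auto intro!: continuous_intros\<close>)
  moreover have "?h (- r) \<le> 0" "0 \<le> ?h r"
    using s s1 by (auto simp: zero_less_divide_iff divide_less_0_iff)
  ultimately obtain b where b: "b \<in> {-r..r}" "?h b = 0"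
    using IVT'[of ?h "- r" 0 r] r by auto
  then have "M + s *\<^sub>R (c + b *\<^sub>R n - M) \<in> frontier \<Omega>"
    using zero in_U by auto
  moreover have "M + s *\<^sub>R (c + b *\<^sub>R n - M) \<in> \<Omega>"
    using b s1 by (intro inside) auto
  ultimately show False
    using \<Omega>(1) by (simp add: frontier_def interior_open)
qed

text \<open>Locally the radial function solves \<open>F (c + l *\<^sub>R u) = 0\<close> for
  \<open>l\<close>. The derivative in \<open>l\<close> is \<open>F' M \<bullet> u\<close>, nonzero
  by transversality because \<open>M - c\<close> is a multiple of \<open>u\<close>.\<close>

lemma C1_on_radial:
  fixes \<Omega> :: "(real^3) set"
  assumes \<Omega>: "open \<Omega>" "convex \<Omega>" "bounded \<Omega>" and surf: "C1_surface (frontier \<Omega>)"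
  shows "C1_on (\<Omega> \<times> (- {0})) (\<lambda>p. radial (frontier \<Omega>) (fst p) (snd p))"
proof (rule C1_on_locallyI)
  fix p assume p: "p \<in> \<Omega> \<times> (- {0 :: real^3})"
  define l M where "l = radial (frontier \<Omega>) (fst p) (snd p)" and "M = fst p + l *\<^sub>R snd p"
  have l: "l > 0" and M: "M \<in> frontier \<Omega>"
    using radial_frontier[OF \<Omega>, of "fst p" "snd p"] p by (simp_all add: l_def M_def mem_Times_iff)
  from surf[unfolded C1_surface_def, THEN bspec, OF M]
  obtain U F F' where U: "open U" "M \<in> U"
    and dF: "\<forall>x\<in>U. (F has_derivative (\<lambda>h. F' x \<bullet> h)) (at x)"
    and cF': "continuous_on U F'" and nz: "\<forall>x\<in>U. F' x \<noteq> 0"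
    and zero: "frontier \<Omega> \<inter> U = {x\<in>U. F x = (0::real)}"
    by (elim exE conjE)
  have transversal: "F' M \<bullet> (M - fst p) \<noteq> 0"
  proof (rule convex_frontier_transversal[OF \<Omega>(1,2) _ U _ _ _ zero M])
    show "fst p \<in> \<Omega>" using p by auto
    show "isCont F x" if "x \<in> U" for x
      using bspec[OF dF that] by (rule has_derivative_continuous)
    show "(F has_derivative (\<lambda>h. F' M \<bullet> h)) (at M)" "F' M \<noteq> 0"
      using dF nz U(2) by auto
  qed
  define m where "m z = fst (fst z) + snd z *\<^sub>R snd (fst z)" for z :: "((real^3) \<times> (real^3)) \<times> real"
  define V where "V = ((\<Omega> \<times> (- {0})) \<times> {0<..}) \<inter> m -` U"
  have oV: "open V"
    unfolding V_def m_def using \<Omega>(1) U(1)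
    by (intro open_Int open_Times open_vimage continuous_intros) auto
  have "C1_on U F"
    by (rule C1_on_openI[OF U(1) bspec[OF dF]]) (auto intro!: continuous_intros cF')
  moreover have "C1_on V m"
    unfolding m_def by (intro C1_on_add C1_on_scaleR C1_on_fst C1_on_snd C1_on_ident)
  ultimately have C1: "C1_on V (\<lambda>z. F (m z))"
    by (intro C1_on_compose[of V m U F]) (auto simp: V_def)
  have pV: "(p, l) \<in> V" "F (m (p, l)) = 0"
    using p l U(2) M zero by (auto simp: V_def m_def M_def[symmetric])
  have "(m has_derivative (\<lambda>h. fst (fst h) + (l *\<^sub>R snd (fst h) + snd h *\<^sub>R snd p))) (at (p, l))"
    unfolding m_def by (auto intro!: derivative_eq_intros)
  moreover have "(F has_derivative (\<lambda>h. F' M \<bullet> h)) (at (m (p, l)))"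
    using dF U(2) by (simp add: m_def M_def)
  ultimately have D0: "((\<lambda>z. F (m z)) has_derivative
      (\<lambda>h. F' M \<bullet> (fst (fst h) + (l *\<^sub>R snd (fst h) + snd h *\<^sub>R snd p)))) (at (p, l))"
    by (rule has_derivative_compose)
  define f where "f z = F (m z)" for z
  define Dm where "Dm h = F' M \<bullet> (fst (fst h) + (l *\<^sub>R snd (fst h) + snd h *\<^sub>R snd p))"
    for h :: "((real^3) \<times> (real^3)) \<times> real"
  have D: "(f has_derivative Dm) (at (p, l))"
    unfolding f_def Dm_def by (rule D0)
  have "F' M \<bullet> snd p \<noteq> 0"
    using transversal by (simp add: M_def)
  moreover have "Dm (0, 1) = F' M \<bullet> snd p"
    unfolding Dm_def by simp
  ultimately have nz': "Dm (0, 1) \<noteq> 0"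
    by metis
  obtain W g where W: "open W" "p \<in> W" "C1_on W g"
    and g: "\<forall>x\<in>W. (x, g x) \<in> V \<and> f (x, g x) = 0"
    using implicit_function_real[OF oV C1[folded f_def] pV(1) pV(2)[folded f_def] D nz']
    by (elim exE conjE)
  \<comment> \<open>Membership in \<open>V\<close> makes the implicit solution positive and keeps
    the centre in \<open>\<Omega>\<close>; as a ray meets the frontier only once, this solution is
    the radial function.\<close>
  have "g x = radial (frontier \<Omega>) (fst x) (snd x)" if "x \<in> W" for x
    by (rule radial_eqI[OF \<Omega>(1,2), symmetric]) (use bspec[OF g that] zero in \<open>auto simp: V_def m_def f_def\<close>)
  with W show "\<exists>U g. open U \<and> p \<in> U \<and> C1_on U g \<and>
      (\<forall>x\<in>\<Omega> \<times> (- {0}) \<inter> U. g x = radial (frontier \<Omega>) (fst x) (snd x))"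
    by (intro exI[of _ W] exI[of _ g]) auto
qed

subsection \<open>Quaternion rotations\<close>

text \<open>The Euler-Rodrigues formula. It is polynomial in \<open>x\<close> and \<open>u\<close>,
  so linearity, regularity and derivatives of rotations follow from the rules for sums and
  products.\<close>

lemma qrotate_eq:
  "qrotate x u = ((fst x)\<^sup>2 - snd x \<bullet> snd x) *\<^sub>R u + (2 * fst x) *\<^sub>R cross3 (snd x) u
    + (2 * (snd x \<bullet> u)) *\<^sub>R snd x"
  by (simp add: qrotate_def qmult_def qconj_def qimag_def cross3_simps forall_3 power2_eq_square)

lemma fst_qconj: "fst (qconj x) = fst x" and snd_qconj: "snd (qconj x) = - snd x"
  by (simp_all add: qconj_def)

lemma norm_qconj: "norm (qconj x) = norm x"
  by (simp add: norm_prod_def fst_qconj snd_qconj)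

lemma qconj_qconj: "qconj (qconj x) = x"
  by (simp add: qconj_def)

lemma norm_quat: "(norm x)\<^sup>2 = (fst x)\<^sup>2 + snd x \<bullet> snd x" for x :: quat
  by (simp add: norm_prod_def power2_norm_eq_inner)

lemma bounded_linear_qrotate: "bounded_linear (qrotate x)"
  unfolding qrotate_eq
  by (intro bounded_linear_add bounded_linear_const_scaleR bounded_linear_ident
      bounded_linear_scaleR_const bounded_linear_const_mult bounded_linear_inner_right
      bounded_bilinear.bounded_linear_right[OF bounded_bilinear_cross3])

lemma qrotate_simps:
  "qrotate x (u + w) = qrotate x u + qrotate x w" "qrotate x (u - w) = qrotate x u - qrotate x w"
  "qrotate x (- u) = - qrotate x u" "qrotate x (r *\<^sub>R u) = r *\<^sub>R qrotate x u" "qrotate x 0 = 0"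
  using linear_add linear_diff linear_neg linear_scale linear_0
    bounded_linear.linear[OF bounded_linear_qrotate[of x]] by metis+

text \<open>This and the next lemma are polynomial identities for arbitrary quaternions, with the
  fourth power of the norm as factor; unit norm is inserted only afterwards.\<close>

lemma qrotate_inner_aux:
  "qrotate x u \<bullet> qrotate x w = ((fst x)\<^sup>2 + snd x \<bullet> snd x)\<^sup>2 * (u \<bullet> w)"
  by (simp add: qrotate_eq cross3_simps power2_eq_square)

lemma qrotate_qconj_aux:
  "qrotate (qconj x) (qrotate x u) = ((fst x)\<^sup>2 + snd x \<bullet> snd x)\<^sup>2 *\<^sub>R u"
  by (simp add: qrotate_eq fst_qconj snd_qconj cross3_simps forall_3 power2_eq_square)

lemma
  assumes "norm x = 1"
  shows qrotate_inner: "qrotate x u \<bullet> qrotate x w = u \<bullet> w"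
    and norm_qrotate: "norm (qrotate x u) = norm u"
    and qconj_qrotate: "qrotate (qconj x) (qrotate x u) = u"
    and qrotate_qconj: "qrotate x (qrotate (qconj x) u) = u"
proof -
  have 1: "(fst y)\<^sup>2 + snd y \<bullet> snd y = 1" if "norm y = 1" for y :: quat
    using norm_quat[of y] that by simp
  show "qrotate x u \<bullet> qrotate x w = u \<bullet> w" for u w
    by (simp add: qrotate_inner_aux 1 assms)
  then show "norm (qrotate x u) = norm u"
    by (simp add: norm_eq_sqrt_inner)
  show "qrotate (qconj x) (qrotate x u) = u"
    by (simp add: qrotate_qconj_aux 1 assms)
  show "qrotate x (qrotate (qconj x) u) = u"
    using qrotate_qconj_aux[of "qconj x" u] 1[of "qconj x"] assms by (simp add: qconj_qconj norm_qconj)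
qed

lemma C1_on_qrotate: "C1_on S x \<Longrightarrow> C1_on S u \<Longrightarrow> C1_on S (\<lambda>p. qrotate (x p) (u p))"
  unfolding qrotate_eq power2_eq_square
  by (intro C1_on_add C1_on_diff C1_on_scaleR C1_on_mult C1_on_inner C1_on_cross3 C1_on_fst C1_on_snd
      C1_on_const)

text \<open>\<open>q'\<close> is left arbitrary so that the formula serves both the orientation and
  its conjugate, which obey different differential equations.\<close>

lemma has_vector_derivative_qrotate_aux:
  assumes q: "(q has_vector_derivative q') (at t within S)" and x: "(x has_vector_derivative x') (at t within S)"
  shows "((\<lambda>t. qrotate (q t) (x t)) has_vector_derivative
    (2 * (fst (q t) * fst q' - snd (q t) \<bullet> snd q')) *\<^sub>R x t
    + (2 * fst q') *\<^sub>R cross3 (snd (q t)) (x t) + (2 * fst (q t)) *\<^sub>R cross3 (snd q') (x t)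
    + (2 * (snd q' \<bullet> x t)) *\<^sub>R snd (q t) + (2 * (snd (q t) \<bullet> x t)) *\<^sub>R snd q' + qrotate (q t) x') (at t within S)"
proof -
  have a: "((\<lambda>t. fst (q t)) has_vector_derivative fst q') (at t within S)"
    and b: "((\<lambda>t. snd (q t)) has_vector_derivative snd q') (at t within S)"
    using q by (auto intro: bounded_linear.has_vector_derivative[OF bounded_linear_fst]
        bounded_linear.has_vector_derivative[OF bounded_linear_snd])
  note inner = bounded_bilinear.has_vector_derivative[OF bounded_bilinear_inner]
  note scale = bounded_bilinear.has_vector_derivative[OF bounded_bilinear_scaleR]
  note cross = bounded_bilinear.has_vector_derivative[OF bounded_bilinear_cross3]
  note mult = bounded_bilinear.has_vector_derivative[OF bounded_bilinear_mult]
  have "((\<lambda>t. (fst (q t) * fst (q t) - snd (q t) \<bullet> snd (q t)) *\<^sub>R x t + (2 * fst (q t)) *\<^sub>R cross3 (snd (q t)) (x t)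
    + (2 * (snd (q t) \<bullet> x t)) *\<^sub>R snd (q t)) has_vector_derivative
     ((fst (q t) * fst (q t) - snd (q t) \<bullet> snd (q t)) *\<^sub>R x' +
      (fst (q t) * fst q' + fst q' * fst (q t) - (snd (q t) \<bullet> snd q' + snd q' \<bullet> snd (q t))) *\<^sub>R x t
     + ((2 * fst (q t)) *\<^sub>R (cross3 (snd (q t)) x' + cross3 (snd q') (x t)) +
      (2 * fst q' + 0 * fst (q t)) *\<^sub>R cross3 (snd (q t)) (x t))
     + ((2 * (snd (q t) \<bullet> x t)) *\<^sub>R snd q' +
       (2 * (snd (q t) \<bullet> x' + snd q' \<bullet> x t) + 0 * (snd (q t) \<bullet> x t)) *\<^sub>R snd (q t)))) (at t within S)"
    by (intro has_vector_derivative_add has_vector_derivative_diff scale cross inner mult a b x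
        has_vector_derivative_const)
  then show ?thesis
    unfolding qrotate_eq power2_eq_square
    by (rule has_vector_derivative_eq_rhs) (simp add: algebra_simps inner_commute)
qed

text \<open>The transport formula of a rotating frame. The factor 1/2 disappears because the
  quaternion occurs twice in the rotation.\<close>

lemma has_vector_derivative_qrotate:
  assumes "(q has_vector_derivative (1/2) *\<^sub>R qmult (q t) (qimag w)) (at t within S)"
    and "(x has_vector_derivative x') (at t within S)"
  shows "((\<lambda>t. qrotate (q t) (x t)) has_vector_derivative
    qrotate (q t) (cross3 w (x t) + x')) (at t within S)"
  by (rule has_vector_derivative_eq_rhs[OF has_vector_derivative_qrotate_aux[OF assms]])
    (simp add: qrotate_eq qmult_def qimag_def cross3_simps forall_3 power2_eq_square
        add_divide_distrib diff_divide_distrib)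

lemma has_vector_derivative_qconj_qrotate:
  assumes q: "(q has_vector_derivative (1/2) *\<^sub>R qmult (q t) (qimag w)) (at t within S)"
    and x: "(x has_vector_derivative x') (at t within S)"
  shows "((\<lambda>t. qrotate (qconj (q t)) (x t)) has_vector_derivative
    cross3 (qrotate (qconj (q t)) (x t)) w + qrotate (qconj (q t)) x') (at t within S)"
proof -
  have "bounded_linear qconj"
    unfolding qconj_def by (intro bounded_linear_Pair bounded_linear_minus bounded_linear_fst bounded_linear_snd)
  from bounded_linear.has_vector_derivative[OF this q]
  have "((\<lambda>t. qconj (q t)) has_vector_derivative qconj ((1/2) *\<^sub>R qmult (q t) (qimag w))) (at t within S)" .
  from has_vector_derivative_qrotate_aux[OF this x] show ?thesis
    by (rule has_vector_derivative_eq_rhs)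
      (simp add: qrotate_eq qmult_def qimag_def qconj_def cross3_simps forall_3 power2_eq_square
          add_divide_distrib diff_divide_distrib)
qed

subsection \<open>Advection on the sphere\<close>

text \<open>Along the great circle leaving \<eta> in the direction of \<open>w - w'\<close>, both
  vectors must give the derivative of \<open>h\<close>; the two values differ by
  \<open>norm (w - w')\<close>.\<close>

lemma sphere_grad_unique:
  fixes \<eta> :: "real^3"
  assumes \<eta>: "\<eta> \<in> sphere 0 1" and w: "w \<bullet> \<eta> = 0" "w' \<bullet> \<eta> = 0"
    and h: "(h has_derivative (\<lambda>x. w \<bullet> x)) (at \<eta> within sphere 0 1)"
      "(h has_derivative (\<lambda>x. w' \<bullet> x)) (at \<eta> within sphere 0 1)"
  shows "w = w'"
proof (rule ccontr)
  assume "w \<noteq> w'"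
  define e where "e = (w - w') /\<^sub>R norm (w - w')"
  define y where "y \<theta> = cos \<theta> *\<^sub>R \<eta> + sin \<theta> *\<^sub>R e" for \<theta> :: real
  have e: "norm e = 1" "e \<bullet> \<eta> = 0"
    using \<open>w \<noteq> w'\<close> w by (simp_all add: e_def inner_diff_left)
  have \<eta>1: "\<eta> \<bullet> \<eta> = 1" "e \<bullet> e = 1"
    using \<eta> e by (simp_all add: dot_square_norm)
  have y: "y \<theta> \<in> sphere 0 1" for \<theta>
  proof -
    have "y \<theta> \<bullet> y \<theta> = (cos \<theta>)\<^sup>2 + (sin \<theta>)\<^sup>2"
      using \<eta>1 e(2) by (simp add: y_def inner_simps inner_commute power2_eq_square)
    then show ?thesis
      by (simp add: norm_eq_sqrt_inner)
  qed
  have y0: "y 0 = \<eta>" by (simp add: y_def)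
  have dy: "(y has_derivative (\<lambda>s. s *\<^sub>R e)) (at 0)"
    unfolding y_def by (auto intro!: derivative_eq_intros)
  have "((\<lambda>\<theta>. h (y \<theta>)) has_derivative (\<lambda>s. v \<bullet> (s *\<^sub>R e))) (at 0)"
    if "(h has_derivative (\<lambda>x. v \<bullet> x)) (at \<eta> within sphere 0 1)" for v
    by (rule has_derivative_in_compose[OF dy], rule has_derivative_subset[OF that[folded y0]])
      (use y in auto)
  from has_derivative_unique[OF this[OF h(1)] this[OF h(2)]]
  have "w \<bullet> (1 *\<^sub>R e) = w' \<bullet> (1 *\<^sub>R e)"
    by (rule fun_cong)
  then have "(w - w') \<bullet> e = 0"
    by (simp add: inner_diff_left)
  then have "(w - w') \<bullet> (w - w') = 0"
    using \<open>w \<noteq> w'\<close> by (simp add: e_def)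
  with \<open>w \<noteq> w'\<close> show False
    by simp
qed

lemma sphere_grad_inner:
  fixes \<eta> :: "real^3"
  assumes \<eta>: "\<eta> \<in> sphere 0 1" and h: "(h has_derivative L) (at \<eta> within sphere 0 1)" and x: "x \<bullet> \<eta> = 0"
  shows "sphere_grad h \<eta> \<bullet> x = L x"
proof -
  interpret L: bounded_linear L
    using h by (rule has_derivative_bounded_linear)
  define l where "l = adjoint L 1"
  have L: "L x = l \<bullet> x" for x
    using adjoint_works[OF L.linear, of x 1] by (simp add: l_def inner_commute)
  define w where "w = l - (l \<bullet> \<eta>) *\<^sub>R \<eta>"
  have \<eta>1: "\<eta> \<bullet> \<eta> = 1"
    using \<eta> by (simp add: dot_square_norm)
  \<comment> \<open>\<open>L\<close> may act on normal vectors as well. The subtracted term vanishes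
    on the sphere and its derivative is the normal part of \<open>L\<close>, so the tangential
    vector \<open>w\<close> represents the derivative of \<open>h\<close>.\<close>
  have "((\<lambda>y. h y - (l \<bullet> \<eta>) / 2 * (y \<bullet> y - 1)) has_derivative
      (\<lambda>x. L x - (l \<bullet> \<eta>) / 2 * (\<eta> \<bullet> x + x \<bullet> \<eta>))) (at \<eta> within sphere 0 1)"
    by (auto intro!: derivative_eq_intros h)
  moreover have "(\<lambda>x. L x - (l \<bullet> \<eta>) / 2 * (\<eta> \<bullet> x + x \<bullet> \<eta>)) = (\<lambda>x. w \<bullet> x)"
    by (simp add: L w_def inner_simps inner_commute fun_eq_iff)
  ultimately have "((\<lambda>y. h y - (l \<bullet> \<eta>) / 2 * (y \<bullet> y - 1)) has_derivative (\<lambda>x. w \<bullet> x)) (at \<eta> within sphere 0 1)"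
    by simp
  then have w: "(h has_derivative (\<lambda>x. w \<bullet> x)) (at \<eta> within sphere 0 1)"
    by (rule has_derivative_transform[OF \<eta>, rotated]) (simp add: dot_square_norm)
  moreover have w0: "w \<bullet> \<eta> = 0"
    by (simp add: w_def inner_diff_left \<eta>1)
  ultimately have "sphere_grad h \<eta> = w"
    unfolding sphere_grad_def using sphere_grad_unique[OF \<eta>]
    by (intro the_equality) blast+
  then show ?thesis
    using x by (simp add: w_def inner_simps L inner_commute)
qed

lemma at_within_Ici_neq_bot:
  fixes t :: real
  assumes "t \<ge> 0"
  shows "at t within {0..} \<noteq> bot"
proof -
  have "at_right t \<le> at t within {0..}"
    using assms by (intro at_le) auto
  then show ?thesis
    using trivial_limit_at_right_real[of t] by (metis bot.extremum_uniqueI)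
qed

lemma has_real_derivative_Ici_unique:
  fixes f :: "real \<Rightarrow> real"
  assumes "t \<ge> 0" "(f has_real_derivative a) (at t within {0..})" "(f has_real_derivative b) (at t within {0..})"
  shows "a = b"
  using vector_derivative_unique_within[OF at_within_Ici_neq_bot[OF assms(1)]] assms(2,3)
  unfolding has_real_derivative_iff_has_vector_derivative by blast

lemma constant_on_Ici:
  fixes f :: "real \<Rightarrow> 'a::real_normed_vector"
  assumes "\<And>\<tau>. \<tau> \<ge> 0 \<Longrightarrow> (f has_vector_derivative 0) (at \<tau> within {0..})" "t \<ge> 0"
  shows "f t = f 0"
proof -
  obtain c where "\<And>\<tau>. \<tau> \<in> {0..} \<Longrightarrow> f \<tau> = c"
    using has_vector_derivative_zero_constant[of "{0..}" f] assms(1) by auto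
  then show ?thesis
    using assms(2) by simp
qed

lemma has_derivative_Ici_cong:
  fixes f g :: "real \<Rightarrow> real"
  assumes "(f has_real_derivative d) (at t within {0..})" "t \<ge> 0" "\<And>\<tau>. \<tau> \<ge> 0 \<Longrightarrow> g \<tau> = f \<tau>"
  shows "(g has_real_derivative d) (at t within {0..})"
  using has_derivative_transform[of t "{0..}" g f] assms unfolding has_field_derivative_def by auto

text \<open>
  The advection equation \<open>\<partial>\<^sub>t h = e - \<nabla>h \<cdot> x\<close> at a point is an ordinary differential equation
  along any curve through that point with velocity \<open>x\<close>.
\<close>

lemma advection_along_curve:
  fixes h :: "real \<Rightarrow> real^3 \<Rightarrow> real"
  assumes h: "(\<lambda>(t, \<eta>). h t \<eta>) differentiable_on time_sphere" and t: "t \<ge> 0"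
    and \<phi>: "\<And>\<tau>. \<tau> \<ge> 0 \<Longrightarrow> \<phi> \<tau> \<in> sphere 0 1" "\<phi> t = \<eta>"
      "(\<phi> has_vector_derivative x) (at t within {0..})" and x: "x \<bullet> \<eta> = 0"
  shows "((\<lambda>\<tau>. h \<tau> \<eta>) has_real_derivative e - sphere_grad (h t) \<eta> \<bullet> x) (at t within {0..}) \<longleftrightarrow>
    ((\<lambda>\<tau>. h \<tau> (\<phi> \<tau>)) has_real_derivative e) (at t within {0..})"
proof -
  have \<eta>: "\<eta> \<in> sphere 0 1"
    using \<phi> t by blast
  then have "(t, \<eta>) \<in> time_sphere"
    using t by simp
  with h obtain L where L: "((\<lambda>(t, \<eta>). h t \<eta>) has_derivative L) (at (t, \<eta>) within time_sphere)"
    unfolding differentiable_on_def differentiable_def by blast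
  interpret L: bounded_linear L
    using L by (rule has_derivative_bounded_linear)
  \<comment> \<open>Applied to the constant curve and to \<open>\<phi>\<close>. The resulting
    derivatives \<open>L (1, 0)\<close> and \<open>L (1, x)\<close> differ by the spatial term
    \<open>L (0, x)\<close>, which is the gradient paired with \<open>x\<close>.\<close>
  have *: "((\<lambda>\<tau>. h \<tau> (\<psi> \<tau>)) has_real_derivative L (1, y)) (at t within {0..})"
    if \<psi>: "\<And>\<tau>. \<tau> \<ge> 0 \<Longrightarrow> \<psi> \<tau> \<in> sphere 0 1" "\<psi> t = \<eta>" "(\<psi> has_vector_derivative y) (at t within {0..})" for \<psi> y
  proof -
    have "((\<lambda>\<tau>. (\<tau>, \<psi> \<tau>)) has_derivative (\<lambda>s. (s, s *\<^sub>R y))) (at t within {0..})"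
      using \<psi>(3) unfolding has_vector_derivative_def by (intro has_derivative_Pair has_derivative_ident)
    moreover have "((\<lambda>(t, \<eta>). h t \<eta>) has_derivative L) (at (t, \<psi> t) within (\<lambda>\<tau>. (\<tau>, \<psi> \<tau>)) ` {0..})"
      unfolding \<psi>(2) by (rule has_derivative_subset[OF L]) (use \<psi> in auto)
    ultimately have "((\<lambda>\<tau>. h \<tau> (\<psi> \<tau>)) has_derivative (\<lambda>s. L (s, s *\<^sub>R y))) (at t within {0..})"
      using has_derivative_in_compose[of "\<lambda>\<tau>. (\<tau>, \<psi> \<tau>)" _ t "{0..}"] by fastforce
    moreover have "L (s, s *\<^sub>R y) = L (1, y) * s" for s
      using L.scaleR[of s "(1, y)"] by (simp add: mult.commute)
    ultimately show ?thesis
      by (simp add: has_field_derivative_def mult_commute_abs)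
  qed
  have L0: "((\<lambda>\<tau>. h \<tau> \<eta>) has_real_derivative L (1, 0)) (at t within {0..})"
    by (rule *) (use \<eta> in \<open>auto intro!: derivative_eq_intros\<close>)
  have Lx: "((\<lambda>\<tau>. h \<tau> (\<phi> \<tau>)) has_real_derivative L (1, x)) (at t within {0..})"
    by (rule *) (use \<phi> in auto)
  have sum: "L (1, x) = L (1, 0) + sphere_grad (h t) \<eta> \<bullet> x"
  proof -
    have "((\<lambda>y. (t, y)) has_derivative (\<lambda>y. (0, y))) (at \<eta> within sphere 0 1)"
      by (auto intro!: derivative_eq_intros)
    moreover have "((\<lambda>(t, \<eta>). h t \<eta>) has_derivative L) (at (t, \<eta>) within (\<lambda>y. (t, y)) ` sphere 0 1)"
      by (rule has_derivative_subset[OF L]) (use t in auto)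
    ultimately have "(h t has_derivative (\<lambda>y. L (0, y))) (at \<eta> within sphere 0 1)"
      using has_derivative_in_compose[of "\<lambda>y. (t, y)" _ \<eta> "sphere 0 1"] by fastforce
    then have "sphere_grad (h t) \<eta> \<bullet> x = L (0, x)"
      using \<eta> x by (intro sphere_grad_inner)
    then show ?thesis
      using L.add[of "(1, 0)" "(0, x)"] by simp
  qed
  have 1: "((\<lambda>\<tau>. h \<tau> \<eta>) has_real_derivative d) (at t within {0..}) \<longleftrightarrow> L (1, 0) = d" for d
    using has_real_derivative_Ici_unique[OF t L0, of d] L0 by auto
  have 2: "((\<lambda>\<tau>. h \<tau> (\<phi> \<tau>)) has_real_derivative e) (at t within {0..}) \<longleftrightarrow> L (1, x) = e"
    using has_real_derivative_Ici_unique[OF t Lx, of e] Lx by auto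
  show ?thesis
    unfolding 1 2 using sum by linarith
qed

subsection \<open>Depth and scene flow\<close>

lemma depth_eq_radial:
  assumes \<Omega>: "open \<Omega>" "convex \<Omega>" "bounded \<Omega>" and c: "c \<in> \<Omega>" and x: "norm x = 1" and \<eta>: "norm \<eta> = 1"
  shows "depth (frontier \<Omega>) c x \<eta> = radial (frontier \<Omega>) c (qrotate x \<eta>)"
proof -
  define u l where "u = qrotate x \<eta>" and "l = radial (frontier \<Omega>) c u"
  have u: "norm u = 1"
    using norm_qrotate[OF x] \<eta> by (simp add: u_def)
  then have "u \<noteq> 0" by auto
  from radial_frontier[OF \<Omega> c this] have l: "l > 0" "c + l *\<^sub>R u \<in> frontier \<Omega>"
    by (simp_all add: l_def)
  have "seen_point (frontier \<Omega>) c x \<eta> = c + l *\<^sub>R u"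
    unfolding seen_point_def
  proof (rule the_equality)
    show "c + l *\<^sub>R u \<in> frontier \<Omega> \<and> qrotate x \<eta> = (c + l *\<^sub>R u - c) /\<^sub>R norm (c + l *\<^sub>R u - c)"
      using l u by (simp add: u_def[symmetric])
    fix M assume M: "M \<in> frontier \<Omega> \<and> qrotate x \<eta> = (M - c) /\<^sub>R norm (M - c)"
    then have ne: "M \<noteq> c"
      using \<Omega>(1) c by (auto simp: frontier_def interior_open)
    then have M_eq: "M = c + norm (M - c) *\<^sub>R u"
      using M by (simp add: u_def)
    with M have "c + norm (M - c) *\<^sub>R u \<in> frontier \<Omega>"
      by simp
    then have "norm (M - c) = l"
      by (rule ray_frontier_inj[OF \<Omega>(1,2) c, of "norm (M - c)" u l, rotated]) (use ne l in auto)
    with M_eq show "M = c + l *\<^sub>R u"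
      by simp
  qed
  then show ?thesis
    using l u by (simp add: depth_def l_def u_def)
qed

text \<open>For a unit vector \<open>x\<close> the right-hand side is minus the part of
  \<open>y\<close> orthogonal to \<open>x\<close>; thus \<open>g\<close> is minus the tangential
  velocity.\<close>

lemma cross3_cross3_self: "cross3 x (cross3 x y) = (x \<bullet> y) *\<^sub>R x - (x \<bullet> x) *\<^sub>R y"
  by (simp add: cross3_simps forall_3)

lemma norm_g_field:
  assumes "norm \<eta> = 1"
  shows "(norm (g_field v t \<eta>))\<^sup>2 = v t \<bullet> v t - (v t \<bullet> \<eta>)\<^sup>2"
  unfolding g_field_def cross3_cross3_self power2_norm_eq_inner
  using assms by (simp add: inner_simps inner_commute norm_eq_1 power2_eq_square algebra_simps)

lemma flow_field_eq:
  "flow_field v \<omega> \<Gamma> t \<eta> = cross3 \<eta> (\<omega> t + \<Gamma> t \<eta> *\<^sub>R cross3 \<eta> (v t))"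
  by (simp add: flow_field_def f_field_def g_field_def cross_add_right cross_mult_right)

lemma flow_field_orthogonal: "flow_field v \<omega> \<Gamma> t \<eta> \<bullet> \<eta> = 0"
  by (simp add: flow_field_eq dot_cross_self)

section \<open>Pixels and scene points at a given time\<close>

locale camera =
  fixes \<Omega> \<Sigma> :: "(real^3) set" and C v \<omega> :: "real \<Rightarrow> real^3" and q :: "real \<Rightarrow> quat"
    and D \<Gamma> :: "real \<Rightarrow> real^3 \<Rightarrow> real" and \<gamma>bar \<Gamma>bar :: real
  assumes scene: "convex_C1_scene \<Omega> \<Sigma>"
    and motion: "camera_motion \<Omega> C q v \<omega>"
    and D: "D = (\<lambda>t \<eta>. depth \<Sigma> (C t) (q t) \<eta>)"
    and \<Gamma>: "\<Gamma> = (\<lambda>t \<eta>. 1 / D t \<eta>)"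
    and pos: "\<gamma>bar > 0" "\<Gamma>bar > 0"
    and \<Gamma>_bounds: "\<And>t \<eta>. t \<ge> 0 \<Longrightarrow> norm \<eta> = 1 \<Longrightarrow> \<gamma>bar \<le> \<Gamma> t \<eta> \<and> \<Gamma> t \<eta> \<le> \<Gamma>bar"
begin

abbreviation R :: "real \<Rightarrow> real^3 \<Rightarrow> real^3" where "R t \<equiv> qrotate (q t)"
abbreviation R' :: "real \<Rightarrow> real^3 \<Rightarrow> real^3" where "R' t \<equiv> qrotate (qconj (q t))"
abbreviation X :: "real \<Rightarrow> real^3 \<Rightarrow> real^3" where "X \<equiv> flow_field v \<omega> \<Gamma>"

text \<open>At each time \<open>t \<ge> 0\<close>, \<open>point t\<close> and \<open>view t\<close>
  are inverse bijections between the unit sphere and \<open>\<Sigma>\<close>. While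
  \<open>point\<close> involves the depth, \<open>view\<close> is an explicit formula, smooth in
  \<open>M\<close> away from the camera.\<close>

definition point :: "real \<Rightarrow> real^3 \<Rightarrow> real^3" where "point t \<eta> = C t + D t \<eta> *\<^sub>R R t \<eta>"
definition view :: "real \<Rightarrow> real^3 \<Rightarrow> real^3" where "view t M = R' t (M - C t) /\<^sub>R norm (M - C t)"

lemma \<Omega>: "open \<Omega>" "convex \<Omega>" "bounded \<Omega>"
  and \<Sigma>: "\<Sigma> = frontier \<Omega>" and surface: "C1_surface \<Sigma>"
  using scene by (auto simp: convex_C1_scene_def)

lemma compact_\<Sigma>: "compact \<Sigma>"
  using \<Omega>(3) by (simp add: \<Sigma> compact_frontier_bounded)

lemma cont_v: "continuous_on {0..} v" and cont_\<omega>: "continuous_on {0..} \<omega>"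
  using motion by (auto simp: camera_motion_def)

context
  fixes t :: real assumes t: "t \<ge> 0"
begin

lemma C_in: "C t \<in> \<Omega>" and q_norm: "norm (q t) = 1"
  and C_deriv: "(C has_vector_derivative R t (v t)) (at t within {0..})"
  and q_deriv: "(q has_vector_derivative (1/2) *\<^sub>R qmult (q t) (qimag (\<omega> t))) (at t within {0..})"
  using motion t by (auto simp: camera_motion_def)

lemma D_radial: "norm \<eta> = 1 \<Longrightarrow> D t \<eta> = radial \<Sigma> (C t) (R t \<eta>)"
  unfolding D \<Sigma> by (rule depth_eq_radial[OF \<Omega> C_in q_norm])

lemma
  assumes "norm \<eta> = 1"
  shows D_pos: "D t \<eta> > 0" and point_in: "point t \<eta> \<in> \<Sigma>"
proof -
  have "R t \<eta> \<noteq> 0"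
    using norm_qrotate[OF q_norm, of \<eta>] assms by auto
  from radial_frontier[OF \<Omega> C_in this] show "D t \<eta> > 0" "point t \<eta> \<in> \<Sigma>"
    by (simp_all add: D_radial assms point_def \<Sigma>)
qed

lemma \<Gamma>_D: "norm \<eta> = 1 \<Longrightarrow> \<Gamma> t \<eta> * D t \<eta> = 1"
  using D_pos[of \<eta>] by (simp add: \<Gamma>)

lemma view_point:
  assumes \<eta>: "norm \<eta> = 1"
  shows "view t (point t \<eta>) = \<eta>"
  using D_pos[OF \<eta>] \<eta>
  by (simp add: view_def point_def qrotate_simps norm_qrotate[OF q_norm] qconj_qrotate[OF q_norm])

context
  fixes M assumes M: "M \<in> \<Sigma>"
begin

lemma M_ne: "M \<noteq> C t" and M_norm: "norm (M - C t) > 0"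
  using M C_in \<Omega>(1) by (auto simp: \<Sigma> frontier_def interior_open)

lemma norm_view: "norm (view t M) = 1"
  using M_norm q_norm by (simp add: view_def norm_qrotate norm_qconj)

lemma R_view: "R t (view t M) = (M - C t) /\<^sub>R norm (M - C t)"
  by (simp add: view_def qrotate_simps qrotate_qconj[OF q_norm])

lemma D_view: "D t (view t M) = norm (M - C t)"
proof -
  have "radial \<Sigma> (C t) ((M - C t) /\<^sub>R norm (M - C t)) = norm (M - C t)"
    unfolding \<Sigma> by (rule radial_eqI[OF \<Omega>(1,2) C_in M_norm]) (use M M_norm in \<open>simp add: \<Sigma>\<close>)
  then show ?thesis
    using D_radial[OF norm_view] by (simp add: R_view)
qed

lemma \<Gamma>_view: "\<Gamma> t (view t M) = 1 / norm (M - C t)"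
  by (simp add: \<Gamma> D_view)

lemma point_view: "point t (view t M) = M"
  using M_norm by (simp add: point_def D_view R_view)

text \<open>The bound is uniform in time and in the scene point; this margin later allows the decay
  rate to be extended to a neighbourhood of \<open>\<Sigma>\<close>.\<close>

lemma norm_ge: "1 / \<Gamma>bar \<le> norm (M - C t)"
proof -
  have "1 / norm (M - C t) \<le> \<Gamma>bar"
    using \<Gamma>_bounds[OF t norm_view] by (simp add: \<Gamma>_view)
  then show ?thesis
    using M_norm pos by (simp add: field_simps)
qed

lemma inner_view: "R t (v t) \<bullet> (M - C t) = norm (M - C t) * (v t \<bullet> view t M)"
proof -
  have "norm (M - C t) * (v t \<bullet> view t M) = norm (M - C t) * (R t (v t) \<bullet> R t (view t M))"
    by (simp only: qrotate_inner[OF q_norm])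
  then show ?thesis
    using M_norm by (simp add: R_view)
qed

text \<open>To first order, only the velocity component along the line of sight changes the
  distance.\<close>

lemma norm_deriv: "((\<lambda>\<tau>. norm (M - C \<tau>)) has_real_derivative - (v t \<bullet> view t M)) (at t within {0..})"
proof -
  have C: "(C has_derivative (\<lambda>h. h *\<^sub>R R t (v t))) (at t within {0..})"
    using C_deriv unfolding has_vector_derivative_def .
  have "((\<lambda>\<tau>. norm (M - C \<tau>)) has_derivative (\<lambda>h. sgn (M - C t) \<bullet> (0 - h *\<^sub>R R t (v t)))) (at t within {0..})"
  proof (rule has_derivative_compose[of "\<lambda>\<tau>. M - C \<tau>" _ t "{0..}" norm])
    show "((\<lambda>\<tau>. M - C \<tau>) has_derivative (\<lambda>h. 0 - h *\<^sub>R R t (v t))) (at t within {0..})"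
      by (rule has_derivative_diff[OF has_derivative_const C])
    show "(norm has_derivative (\<lambda>h. sgn (M - C t) \<bullet> h)) (at (M - C t))"
      using has_derivative_norm[of "M - C t"] M_ne by (simp add: inner_commute)
  qed
  moreover have "sgn (M - C t) \<bullet> R t (v t) = v t \<bullet> view t M"
    using inner_view M_norm by (simp add: sgn_div_norm inner_commute)
  then have "(\<lambda>h. sgn (M - C t) \<bullet> (0 - h *\<^sub>R R t (v t))) = (\<lambda>h. - (v t \<bullet> view t M) * h)"
    by (simp add: fun_eq_iff)
  ultimately show ?thesis
    by (simp only: has_field_derivative_def)
qed

lemma view_deriv: "((\<lambda>\<tau>. view \<tau> M) has_vector_derivative X t (view t M)) (at t within {0..})"
proof -
  define d where "d = norm (M - C t)"
  have d: "d > 0" using M_norm by (simp add: d_def)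
  have m_eq: "R' t (M - C t) = d *\<^sub>R view t M"
    using d by (simp add: view_def d_def)
  have "((\<lambda>\<tau>. M - C \<tau>) has_vector_derivative 0 - R t (v t)) (at t within {0..})"
    by (intro has_vector_derivative_diff has_vector_derivative_const C_deriv)
  from has_vector_derivative_qconj_qrotate[OF q_deriv this]
  have "((\<lambda>\<tau>. R' \<tau> (M - C \<tau>)) has_vector_derivative
      cross3 (d *\<^sub>R view t M) (\<omega> t) + R' t (0 - R t (v t))) (at t within {0..})"
    unfolding m_eq .
  moreover have "R' t (0 - R t (v t)) = - v t"
    by (simp add: qrotate_simps qconj_qrotate[OF q_norm])
  ultimately have m: "((\<lambda>\<tau>. R' \<tau> (M - C \<tau>)) has_vector_derivative
      cross3 (d *\<^sub>R view t M) (\<omega> t) - v t) (at t within {0..})"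
    by (simp only: add_uminus_conv_diff)
  have "((\<lambda>\<tau>. inverse (norm (M - C \<tau>))) has_real_derivative
      - (inverse (norm (M - C t)) * (- (v t \<bullet> view t M)) * inverse (norm (M - C t)))) (at t within {0..})"
    by (rule DERIV_inverse'[OF norm_deriv]) (use M_norm in simp)
  then have "((\<lambda>\<tau>. inverse (norm (M - C \<tau>))) has_vector_derivative
      (v t \<bullet> view t M) / d\<^sup>2) (at t within {0..})"
    by (simp add: has_real_derivative_iff_has_vector_derivative d_def field_simps power2_eq_square)
  from bounded_bilinear.has_vector_derivative[OF bounded_bilinear_scaleR this m]
  have "((\<lambda>\<tau>. inverse (norm (M - C \<tau>)) *\<^sub>R R' \<tau> (M - C \<tau>)) has_vector_derivative
      inverse d *\<^sub>R (cross3 (d *\<^sub>R view t M) (\<omega> t) - v t)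
      + ((v t \<bullet> view t M) / d\<^sup>2) *\<^sub>R (d *\<^sub>R view t M)) (at t within {0..})"
    unfolding m_eq d_def .
  moreover have "(\<lambda>\<tau>. view \<tau> M) = (\<lambda>\<tau>. inverse (norm (M - C \<tau>)) *\<^sub>R R' \<tau> (M - C \<tau>))"
    by (rule ext) (simp only: view_def)
  \<comment> \<open>With \<eta> the seen direction, \<open>1 / d\<close> is the inverse depth and (v
    . \<eta>) \<eta> - v is \<open>g\<close> by the double cross product, so the terms regroup as f
    + \<Gamma> g.\<close>
  moreover have "inverse d *\<^sub>R (cross3 (d *\<^sub>R view t M) (\<omega> t) - v t)
      + ((v t \<bullet> view t M) / d\<^sup>2) *\<^sub>R (d *\<^sub>R view t M) = X t (view t M)"
    using d norm_view
    by (simp add: flow_field_def f_field_def g_field_def cross3_cross3_self \<Gamma>_view d_def[symmetric] norm_eq_1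
        cross_mult_left scaleR_diff_right field_simps power2_eq_square inner_commute)
  ultimately show ?thesis
    by simp
qed

end

end

end

lemma continuous_on_qrotate:
  fixes x :: "'a::t2_space \<Rightarrow> quat"
  shows "continuous_on S x \<Longrightarrow> continuous_on S u \<Longrightarrow> continuous_on S (\<lambda>t. qrotate (x t) (u t))"
  unfolding qrotate_eq by (intro continuous_intros continuous_on_cross)

lemma continuous_on_qmult_qimag:
  fixes x :: "'a::t2_space \<Rightarrow> quat"
  shows "continuous_on S x \<Longrightarrow> continuous_on S u \<Longrightarrow> continuous_on S (\<lambda>t. qmult (x t) (qimag (u t)))"
  unfolding qmult_def qimag_def fst_conv snd_conv by (intro continuous_intros continuous_on_cross)

lemma C1_fst: "C1_on {0..} f \<Longrightarrow> C1_on time_sphere (\<lambda>p. f (fst p))"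
  for f :: "real \<Rightarrow> 'b::real_normed_vector"
  by (rule C1_on_compose[OF C1_on_fst[OF C1_on_ident]]) auto

section \<open>Regularity of the depth, transport equations and uniqueness of the flow\<close>

context camera begin

lemma cont_C: "continuous_on {0..} C" and cont_q: "continuous_on {0..} q"
  using C_deriv q_deriv
  by (auto simp: continuous_on_eq_continuous_within intro: has_vector_derivative_continuous)

lemma cont_Rv: "continuous_on {0..} (\<lambda>t. R t (v t))"
  by (intro continuous_on_qrotate cont_q cont_v)

lemma C1_C: "C1_on {0..} C"
  by (rule C1_on_halfline[OF C_deriv cont_Rv]) simp

lemma C1_q: "C1_on {0..} q"
  by (rule C1_on_halfline[OF q_deriv])
    (auto intro!: continuous_intros continuous_on_qmult_qimag cont_q cont_\<omega>)

lemma C1_R: "C1_on time_sphere (\<lambda>p. R (fst p) (snd p))"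
  by (intro C1_on_qrotate C1_fst C1_q C1_on_snd C1_on_ident)

lemma C1_D: "C1_on time_sphere (\<lambda>p. D (fst p) (snd p))"
proof -
  have "C1_on time_sphere (\<lambda>p. (C (fst p), R (fst p) (snd p)))"
    by (intro C1_on_Pair C1_fst C1_C C1_R)
  moreover have "(C (fst p), R (fst p) (snd p)) \<in> \<Omega> \<times> (- {0})" if "p \<in> time_sphere" for p
  proof -
    have p: "fst p \<ge> 0" "norm (snd p) = 1"
      using that by auto
    have "norm (R (fst p) (snd p)) = 1"
      using norm_qrotate[OF q_norm[OF p(1)]] p(2) by simp
    then show ?thesis
      using C_in[OF p(1)] by auto
  qed
  ultimately have "C1_on time_sphere (\<lambda>p. radial \<Sigma> (C (fst p)) (R (fst p) (snd p)))"
    using C1_on_compose[OF _ C1_on_radial[OF \<Omega> surface[unfolded \<Sigma>]], of time_sphere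
        "\<lambda>p. (C (fst p), R (fst p) (snd p))"] by (simp add: \<Sigma>)
  moreover have "D (fst p) (snd p) = radial \<Sigma> (C (fst p)) (R (fst p) (snd p))" if "p \<in> time_sphere" for p
    by (rule D_radial) (use that in auto)
  ultimately show ?thesis
    using C1_on_cong[of time_sphere "\<lambda>p. D (fst p) (snd p)"] by simp
qed

lemma C1_\<Gamma>: "C1_on time_sphere (\<lambda>p. \<Gamma> (fst p) (snd p))"
  unfolding \<Gamma>
  by (intro C1_on_divide C1_on_const C1_D less_imp_neq[THEN not_sym] D_pos) auto

lemma C1_point: "C1_on time_sphere (\<lambda>p. point (fst p) (snd p))"
  unfolding point_def by (intro C1_on_add C1_on_scaleR C1_fst C1_C C1_D C1_R)

lemma C1_view:
  assumes "t \<ge> 0"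
  shows "C1_on \<Sigma> (view t)"
proof -
  have "C1_on \<Sigma> (\<lambda>M. inverse (norm (M - C t)) *\<^sub>R R' t (M - C t))"
    by (intro C1_on_scaleR C1_on_inverse C1_on_norm C1_on_diff C1_on_ident C1_on_const C1_on_qrotate)
      (use M_ne[OF assms] in auto)
  then show ?thesis
    by (simp only: view_def[abs_def])
qed

lemma view_sphere: "t \<ge> 0 \<Longrightarrow> M \<in> \<Sigma> \<Longrightarrow> view t M \<in> sphere 0 1"
  by (simp add: norm_view)

lemma flow_exists: "is_sphere_flow X (\<lambda>t s. view t (point 0 s))"
  by (auto simp: is_sphere_flow_def view_point point_in norm_view view_deriv)

text \<open>Scene points give curves \<open>\<tau> \<mapsto> view \<tau> M\<close> through every point of the sphere at every time.\<close>

lemma advection_along_view: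
  fixes h :: "real \<Rightarrow> real^3 \<Rightarrow> real"
  assumes "(\<lambda>(t, \<eta>). h t \<eta>) differentiable_on time_sphere" "t \<ge> 0" "norm \<eta> = 1"
  shows "((\<lambda>\<tau>. h \<tau> \<eta>) has_real_derivative e - sphere_grad (h t) \<eta> \<bullet> X t \<eta>) (at t within {0..}) \<longleftrightarrow>
    ((\<lambda>\<tau>. h \<tau> (view \<tau> (point t \<eta>))) has_real_derivative e) (at t within {0..})"
proof (rule advection_along_curve[OF assms(1,2)])
  note M = point_in[OF assms(2,3)]
  show "view \<tau> (point t \<eta>) \<in> sphere 0 1" if "\<tau> \<ge> 0" for \<tau>
    using view_sphere[OF that M] .
  show "view t (point t \<eta>) = \<eta>"
    using view_point[OF assms(2,3)] .
  then show "((\<lambda>\<tau>. view \<tau> (point t \<eta>)) has_vector_derivative X t \<eta>) (at t within {0..})"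
    using view_deriv[OF assms(2) M] by simp
  show "X t \<eta> \<bullet> \<eta> = 0"
    by (rule flow_field_orthogonal)
qed

lemma differentiable_D: "(\<lambda>(t, \<eta>). D t \<eta>) differentiable_on time_sphere"
  using C1_on_differentiable_on[OF C1_D] by (simp only: case_prod_beta')

lemma differentiable_\<Gamma>: "(\<lambda>(t, \<eta>). \<Gamma> t \<eta>) differentiable_on time_sphere"
  using C1_on_differentiable_on[OF C1_\<Gamma>] by (simp only: case_prod_beta')

lemma D_along_view:
  assumes t: "t \<ge> 0" and M: "M \<in> \<Sigma>"
  shows "((\<lambda>\<tau>. D \<tau> (view \<tau> M)) has_real_derivative - (v t \<bullet> view t M)) (at t within {0..})"
  by (rule has_derivative_Ici_cong[OF norm_deriv[OF t M] t]) (simp add: D_view M)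

lemma D_equation:
  assumes t: "t \<ge> 0" and \<eta>: "norm \<eta> = 1"
  shows "((\<lambda>\<tau>. D \<tau> \<eta>) has_real_derivative - (v t \<bullet> \<eta>) - sphere_grad (D t) \<eta> \<bullet> X t \<eta>) (at t within {0..})"
  unfolding advection_along_view[OF differentiable_D assms]
  using D_along_view[OF t point_in[OF assms]] by (simp add: view_point assms)

lemma \<Gamma>_equation:
  assumes t: "t \<ge> 0" and \<eta>: "norm \<eta> = 1"
  shows "((\<lambda>\<tau>. \<Gamma> \<tau> \<eta>) has_real_derivative (\<Gamma> t \<eta>)\<^sup>2 * (v t \<bullet> \<eta>) - sphere_grad (\<Gamma> t) \<eta> \<bullet> X t \<eta>)
    (at t within {0..})"
  unfolding advection_along_view[OF differentiable_\<Gamma> assms]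
proof -
  let ?M = "point t \<eta>"
  note M = point_in[OF assms]
  have "((\<lambda>\<tau>. inverse (norm (?M - C \<tau>))) has_real_derivative
      - (inverse (norm (?M - C t)) * (- (v t \<bullet> view t ?M)) * inverse (norm (?M - C t)))) (at t within {0..})"
    by (rule DERIV_inverse'[OF norm_deriv[OF t M]]) (use M_norm[OF t M] in simp)
  then have "((\<lambda>\<tau>. \<Gamma> \<tau> (view \<tau> ?M)) has_real_derivative
      - (inverse (norm (?M - C t)) * (- (v t \<bullet> view t ?M)) * inverse (norm (?M - C t)))) (at t within {0..})"
    by (rule has_derivative_Ici_cong[OF _ t]) (simp add: \<Gamma>_view M inverse_eq_divide)
  moreover have "inverse (norm (?M - C t)) = \<Gamma> t \<eta>"
    using \<Gamma>_view[OF t M] by (simp add: view_point assms inverse_eq_divide)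
  ultimately show "((\<lambda>\<tau>. \<Gamma> \<tau> (view \<tau> ?M)) has_real_derivative (\<Gamma> t \<eta>)\<^sup>2 * (v t \<bullet> \<eta>)) (at t within {0..})"
    by (simp add: view_point assms power2_eq_square mult_ac)
qed

text \<open>
  Along a flow line the seen scene point \<open>point \<tau> (\<phi> \<tau> s)\<close> has zero velocity, which identifies the
  flow without a Lipschitz argument.
\<close>

lemma flow_unique:
  assumes \<phi>: "is_sphere_flow X \<phi>" and s: "s \<in> sphere 0 1" and t: "t \<ge> 0"
  shows "\<phi> t s = view t (point 0 s)"
proof -
  have \<phi>s: "\<phi> 0 s = s" and \<phi>1: "\<And>\<tau>. \<tau> \<ge> 0 \<Longrightarrow> norm (\<phi> \<tau> s) = 1"
    and d\<phi>: "\<And>\<tau>. \<tau> \<ge> 0 \<Longrightarrow> ((\<lambda>\<tau>. \<phi> \<tau> s) has_vector_derivative X \<tau> (\<phi> \<tau> s)) (at \<tau> within {0..})"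
    using \<phi> s by (auto simp: is_sphere_flow_def)
  have "((\<lambda>\<tau>. point \<tau> (\<phi> \<tau> s)) has_vector_derivative 0) (at \<tau> within {0..})" if \<tau>: "\<tau> \<ge> 0" for \<tau>
  proof -
    let ?\<eta> = "\<phi> \<tau> s"
    have "((\<lambda>\<tau>. D \<tau> (\<phi> \<tau> s)) has_real_derivative - (v \<tau> \<bullet> ?\<eta>)) (at \<tau> within {0..})"
      using D_equation[OF \<tau> \<phi>1[OF \<tau>]]
      by (subst (asm) advection_along_curve[OF differentiable_D \<tau>, of "\<lambda>\<tau>. \<phi> \<tau> s"])
        (use d\<phi>[OF \<tau>] \<phi>1 in \<open>auto simp: flow_field_orthogonal\<close>)
    then have dD: "((\<lambda>\<tau>. D \<tau> (\<phi> \<tau> s)) has_vector_derivative - (v \<tau> \<bullet> ?\<eta>)) (at \<tau> within {0..})"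
      by (simp add: has_real_derivative_iff_has_vector_derivative)
    have dR: "((\<lambda>\<tau>. R \<tau> (\<phi> \<tau> s)) has_vector_derivative R \<tau> (cross3 (\<omega> \<tau>) ?\<eta> + X \<tau> ?\<eta>)) (at \<tau> within {0..})"
      by (rule has_vector_derivative_qrotate[OF q_deriv[OF \<tau>] d\<phi>[OF \<tau>]])
    have "((\<lambda>\<tau>. point \<tau> (\<phi> \<tau> s)) has_vector_derivative
        R \<tau> (v \<tau>) + (D \<tau> ?\<eta> *\<^sub>R R \<tau> (cross3 (\<omega> \<tau>) ?\<eta> + X \<tau> ?\<eta>) + (- (v \<tau> \<bullet> ?\<eta>)) *\<^sub>R R \<tau> ?\<eta>))
        (at \<tau> within {0..})"
      unfolding point_def
      by (intro has_vector_derivative_add C_deriv \<tau>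
          bounded_bilinear.has_vector_derivative[OF bounded_bilinear_scaleR dD dR])
    \<comment> \<open>The two cross products with \<open>\<omega>\<close> cancel and \<Gamma> D = 1
      removes the depth. What remains, once rotated, cancels the camera velocity and the term from
      the change of depth.\<close>
    moreover have "D \<tau> ?\<eta> *\<^sub>R (cross3 (\<omega> \<tau>) ?\<eta> + X \<tau> ?\<eta>) = (v \<tau> \<bullet> ?\<eta>) *\<^sub>R ?\<eta> - v \<tau>"
    proof -
      have "cross3 (\<omega> \<tau>) ?\<eta> + X \<tau> ?\<eta> = \<Gamma> \<tau> ?\<eta> *\<^sub>R ((v \<tau> \<bullet> ?\<eta>) *\<^sub>R ?\<eta> - v \<tau>)"
        using cross_skew[of "\<omega> \<tau>" ?\<eta>] \<phi>1[OF \<tau>]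
        by (simp add: flow_field_def f_field_def g_field_def cross3_cross3_self norm_eq_1 inner_commute)
      then show ?thesis
        using \<Gamma>_D[OF \<tau> \<phi>1[OF \<tau>]] by (simp only: scaleR_scaleR mult.commute[of "D \<tau> ?\<eta>"] scaleR_one)
    qed
    then have "D \<tau> ?\<eta> *\<^sub>R R \<tau> (cross3 (\<omega> \<tau>) ?\<eta> + X \<tau> ?\<eta>) = (v \<tau> \<bullet> ?\<eta>) *\<^sub>R R \<tau> ?\<eta> - R \<tau> (v \<tau>)"
      by (simp only: qrotate_simps(4)[symmetric] qrotate_simps(2)[symmetric])
    ultimately show ?thesis
      by simp
  qed
  then have "point t (\<phi> t s) = point 0 (\<phi> 0 s)"
    by (rule constant_on_Ici[where f = "\<lambda>\<tau>. point \<tau> (\<phi> \<tau> s)", OF _ t])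
  then have "view t (point t (\<phi> t s)) = view t (point 0 s)"
    by (simp add: \<phi>s)
  then show ?thesis
    by (simp add: view_point t \<phi>1)
qed

end

subsection \<open>The observer\<close>

lemma sphere_sup_norm_attained:
  assumes "continuous_on (sphere 0 1) h"
  shows "\<exists>\<eta>\<in>sphere 0 1. sphere_sup_norm h = \<bar>h \<eta>\<bar>"
    and "\<And>\<eta>. \<eta> \<in> sphere 0 1 \<Longrightarrow> \<bar>h \<eta>\<bar> \<le> sphere_sup_norm h"
proof -
  have "sphere (0::real^3) 1 \<noteq> {}"
    by simp
  then obtain \<eta> where \<eta>: "\<eta> \<in> sphere 0 1" "\<forall>y\<in>sphere 0 1. \<bar>h y\<bar> \<le> \<bar>h \<eta>\<bar>"
    using continuous_attains_sup[OF compact_sphere _ continuous_on_rabs[OF assms]] by blast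
  have "sphere_sup_norm h = \<bar>h \<eta>\<bar>"
    unfolding sphere_sup_norm_def by (rule cSup_eq_maximum) (use \<eta> in auto)
  with \<eta> show "\<exists>\<eta>\<in>sphere 0 1. sphere_sup_norm h = \<bar>h \<eta>\<bar>"
    and "\<And>\<eta>. \<eta> \<in> sphere 0 1 \<Longrightarrow> \<bar>h \<eta>\<bar> \<le> sphere_sup_norm h"
    by auto
qed

text \<open>
  At \<open>z = ((C', C), M)\<close> this is \<open>\<Gamma> |g|\<^sup>2\<close> in the direction \<open>\<eta>\<close> of \<open>M\<close>, by \<open>|g|\<^sup>2 = |v|\<^sup>2 - (v \<cdot> \<eta>)\<^sup>2\<close>; it is
  independent of the orientation of the camera and smooth where \<open>M \<noteq> C\<close>.
\<close>

definition contraction :: "((real^3) \<times> (real^3)) \<times> (real^3) \<Rightarrow> real" where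
  "contraction z = (fst (fst z) \<bullet> fst (fst z)
      - (fst (fst z) \<bullet> (snd z - snd (fst z))) * (fst (fst z) \<bullet> (snd z - snd (fst z)))
        / ((snd z - snd (fst z)) \<bullet> (snd z - snd (fst z)))) / norm (snd z - snd (fst z))"

lemma C1_contraction: "C1_on {z. snd z \<noteq> snd (fst z)} contraction"
  unfolding contraction_def
  by (intro C1_on_divide C1_on_diff C1_on_mult C1_on_inner C1_on_norm C1_on_fst C1_on_snd C1_on_ident) auto

lemma open_contraction: "open {z :: ((real^3) \<times> (real^3)) \<times> (real^3). snd z \<noteq> snd (fst z)}"
  by (intro open_Collect_neq continuous_intros)

section \<open>Decay rate, its time integral and the solution formula\<close>

context camera begin

definition rate :: "real \<Rightarrow> real^3 \<Rightarrow> real" where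
  "rate t M = \<Gamma> t (view t M) * (norm (g_field v t (view t M)))\<^sup>2"

definition gain :: "real \<Rightarrow> real^3 \<Rightarrow> real" where
  "gain t M = integral {0..t} (\<lambda>\<tau>. rate \<tau> M)"

text \<open>In this form time enters only through the continuous path
  \<open>(R t (v t), C t)\<close>, and the formula makes sense for \<open>M\<close> off the surface;
  \<open>C1_on_integral_param\<close> asks for both.\<close>

lemma rate_eq:
  assumes t: "t \<ge> 0" and M: "M \<in> \<Sigma>"
  shows "rate t M = contraction ((R t (v t), C t), M)"
proof -
  have d: "norm (M - C t) > 0"
    by (rule M_norm[OF assms])
  have "R t (v t) \<bullet> R t (v t) = v t \<bullet> v t"
    by (rule qrotate_inner[OF q_norm[OF t]])
  moreover have "(M - C t) \<bullet> (M - C t) = norm (M - C t) * norm (M - C t)"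
    by (simp add: dot_square_norm power2_eq_square)
  ultimately show ?thesis
    using d by (simp add: contraction_def rate_def norm_g_field[unfolded power2_eq_square] norm_view[OF assms] \<Gamma>_view[OF assms]
        inner_view[OF assms] power2_eq_square)
qed

lemma C1_gain: "C1_on ({0..} \<times> \<Sigma>) (\<lambda>p. gain (fst p) (snd p))"
proof -
  \<comment> \<open>By \<open>norm_ge\<close> the camera is outside this neighbourhood at all times,
    so one open set carries the whole integral.\<close>
  define W where "W = (\<Union>M\<in>\<Sigma>. ball M (1 / \<Gamma>bar))"
  have "C1_on ({0..} \<times> W) (\<lambda>(t, M). integral {0..t} (\<lambda>\<tau>. contraction ((R \<tau> (v \<tau>), C \<tau>), M)))"
  proof (rule C1_on_integral_param[OF open_contraction C1_contraction])
    show "open W"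
      by (auto simp: W_def)
    show "continuous_on {0..} (\<lambda>\<tau>. (R \<tau> (v \<tau>), C \<tau>))"
      by (intro continuous_on_Pair cont_Rv cont_C)
    fix \<tau> :: real and M' assume \<tau>: "\<tau> \<ge> 0" and "M' \<in> W"
    then obtain M where M: "M \<in> \<Sigma>" "dist M M' < 1 / \<Gamma>bar"
      by (auto simp: W_def)
    with norm_ge[OF \<tau> M(1)] have "M' \<noteq> C \<tau>"
      by (auto simp: dist_norm)
    then show "((R \<tau> (v \<tau>), C \<tau>), M') \<in> {z. snd z \<noteq> snd (fst z)}"
      by simp
  qed
  then have "C1_on ({0..} \<times> \<Sigma>) (\<lambda>(t, M). integral {0..t} (\<lambda>\<tau>. contraction ((R \<tau> (v \<tau>), C \<tau>), M)))"
    by (rule C1_on_subset) (use pos in \<open>auto simp: W_def\<close>)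
  moreover have "gain t M = integral {0..t} (\<lambda>\<tau>. contraction ((R \<tau> (v \<tau>), C \<tau>), M))" if "M \<in> \<Sigma>" for t M
    unfolding gain_def by (rule Henstock_Kurzweil_Integration.integral_cong) (use that in \<open>simp add: rate_eq\<close>)
  ultimately show ?thesis
    by (subst C1_on_cong[where g = "\<lambda>(t, M). integral {0..t} (\<lambda>\<tau>. contraction ((R \<tau> (v \<tau>), C \<tau>), M))"]) auto
qed

lemma cont_view: "M \<in> \<Sigma> \<Longrightarrow> continuous_on {0..} (\<lambda>\<tau>. view \<tau> M)"
  using view_deriv by (auto simp: continuous_on_eq_continuous_within intro: has_vector_derivative_continuous)

lemma cont_g_view:
  assumes "M \<in> \<Sigma>"
  shows "continuous_on {0..} (\<lambda>\<tau>. (norm (g_field v \<tau> (view \<tau> M)))\<^sup>2)"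
  unfolding g_field_def by (intro continuous_intros continuous_on_cross cont_view cont_v assms)

lemma cont_rate:
  assumes M: "M \<in> \<Sigma>"
  shows "continuous_on {0..} (\<lambda>\<tau>. rate \<tau> M)"
proof -
  have "continuous_on {0..} (\<lambda>\<tau>. 1 / norm (M - C \<tau>) * (norm (g_field v \<tau> (view \<tau> M)))\<^sup>2)"
    by (intro continuous_intros cont_g_view cont_C M) (use M_ne[OF _ M] in auto)
  then show ?thesis
    by (rule continuous_on_eq) (simp add: rate_def \<Gamma>_view M)
qed

lemma rate_ge:
  assumes "t \<ge> 0" "M \<in> \<Sigma>"
  shows "\<gamma>bar * (norm (g_field v t (view t M)))\<^sup>2 \<le> rate t M"
  unfolding rate_def using \<Gamma>_bounds[OF assms(1) norm_view[OF assms]] by (intro mult_right_mono) auto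

lemma rate_nonneg: "t \<ge> 0 \<Longrightarrow> M \<in> \<Sigma> \<Longrightarrow> rate t M \<ge> 0"
  using rate_ge[of t M] pos by (smt (verit) mult_nonneg_nonneg zero_le_power2)

lemma rate_integrable: "M \<in> \<Sigma> \<Longrightarrow> a \<ge> 0 \<Longrightarrow> (\<lambda>\<tau>. rate \<tau> M) integrable_on {a..b}"
  by (rule integrable_continuous_interval, rule continuous_on_subset[OF cont_rate]) auto

lemma gain_0: "gain 0 M = 0"
  by (simp add: gain_def)

lemma gain_mono:
  assumes M: "M \<in> \<Sigma>" and t: "0 \<le> t" "t \<le> t'"
  shows "gain t M \<le> gain t' M"
  unfolding gain_def
  by (rule integral_subset_le) (use assms rate_integrable rate_nonneg in auto)

text \<open>Here the lower bound on the inverse depth enters; it is the origin of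
  \<open>\<gamma>bar\<close> in the decay exponent.\<close>

lemma gain_ge:
  assumes M: "M \<in> \<Sigma>"
  shows "\<gamma>bar * integral {0..t} (\<lambda>\<tau>. (norm (g_field v \<tau> (view \<tau> M)))\<^sup>2) \<le> gain t M"
proof -
  have "(\<lambda>\<tau>. (norm (g_field v \<tau> (view \<tau> M)))\<^sup>2) integrable_on {0..t}"
    by (rule integrable_continuous_interval, rule continuous_on_subset[OF cont_g_view[OF M]]) auto
  then have "integral {0..t} (\<lambda>\<tau>. \<gamma>bar * (norm (g_field v \<tau> (view \<tau> M)))\<^sup>2) \<le> gain t M"
    unfolding gain_def
    by (intro integral_le integrable_on_mult_right rate_integrable M) (use rate_ge M in auto)
  then show ?thesis
    by simp
qed

lemma gain_deriv:
  assumes t: "t \<ge> 0" and M: "M \<in> \<Sigma>"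
  shows "((\<lambda>t. gain t M) has_real_derivative rate t M) (at t within {0..})"
proof -
  \<comment> \<open>The interval ends beyond \<open>t\<close>, so that near \<open>t\<close> it
    coincides with the half-line.\<close>
  have "((\<lambda>t. gain t M) has_vector_derivative rate t M) (at t within {0..t + 1})"
    unfolding gain_def
    by (rule integral_has_vector_derivative) (use t in \<open>auto intro: continuous_on_subset[OF cont_rate[OF M]]\<close>)
  moreover have "at t within {0..t + 1} = at t within {0..}"
    by (rule at_within_nhd[of t "{..<t + 1}"]) auto
  ultimately show ?thesis
    by (simp add: has_real_derivative_iff_has_vector_derivative)
qed

text \<open>The \<open>f_field\<close> terms cancel and leave (1 - \<Gamma> y) g; then \<Gamma> D =
  1 turns 1 - \<Gamma> y into - \<Gamma> (y - D).\<close>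

lemma innovation_eq:
  assumes t: "t \<ge> 0" and \<eta>: "norm \<eta> = 1"
  shows "k * (g_field v t \<eta> \<bullet> (y *\<^sub>R f_field \<omega> t \<eta> + g_field v t \<eta> - y *\<^sub>R X t \<eta>))
    = - k * (\<Gamma> t \<eta> * (norm (g_field v t \<eta>))\<^sup>2) * (y - D t \<eta>)"
proof -
  have "y *\<^sub>R f_field \<omega> t \<eta> + g_field v t \<eta> - y *\<^sub>R X t \<eta> = (1 - \<Gamma> t \<eta> * y) *\<^sub>R g_field v t \<eta>"
    by (simp add: flow_field_def algebra_simps)
  moreover have "1 - \<Gamma> t \<eta> * y = - (\<Gamma> t \<eta> * (y - D t \<eta>))"
    using \<Gamma>_D[OF assms] by (simp add: algebra_simps)
  ultimately show ?thesis
    by (simp add: power2_norm_eq_inner)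
qed

text \<open>For fixed \<open>t\<close> every pixel is \<open>view t M\<close> for exactly one scene
  point, so both sides quantify over the same instances; joint differentiability translates each
  instance by the chain rule.\<close>

lemma observer_solution_iff:
  "observer_solution k v \<omega> \<Gamma> D\<^sub>0 Dh \<longleftrightarrow>
     (\<lambda>(t, \<eta>). Dh t \<eta>) differentiable_on time_sphere \<and>
     (\<forall>\<eta>\<in>sphere 0 1. Dh 0 \<eta> = D\<^sub>0 \<eta>) \<and>
     (\<forall>t\<ge>0. \<forall>M\<in>\<Sigma>. ((\<lambda>\<tau>. Dh \<tau> (view \<tau> M)) has_real_derivative
        - (v t \<bullet> view t M) - k * rate t M * (Dh t (view t M) - D t (view t M))) (at t within {0..}))"
    (is "_ \<longleftrightarrow> ?diff \<and> ?init \<and> ?ode")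
proof (cases ?diff)
  case True
  have eq: "((\<lambda>\<tau>. Dh \<tau> \<eta>) has_real_derivative
           (- (sphere_grad (Dh t) \<eta> \<bullet> X t \<eta>) - v t \<bullet> \<eta>
            + k * (g_field v t \<eta> \<bullet> (Dh t \<eta> *\<^sub>R f_field \<omega> t \<eta> + g_field v t \<eta> - Dh t \<eta> *\<^sub>R X t \<eta>))))
          (at t within {0..}) \<longleftrightarrow>
      ((\<lambda>\<tau>. Dh \<tau> (view \<tau> (point t \<eta>))) has_real_derivative
        - (v t \<bullet> \<eta>) - k * (\<Gamma> t \<eta> * (norm (g_field v t \<eta>))\<^sup>2) * (Dh t \<eta> - D t \<eta>)) (at t within {0..})"
    if "t \<ge> 0" "norm \<eta> = 1" for t \<eta>
    unfolding innovation_eq[OF that] advection_along_view[OF True that, symmetric]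
    by (simp add: algebra_simps)
  have "(\<forall>\<eta>\<in>sphere 0 1. ((\<lambda>\<tau>. Dh \<tau> \<eta>) has_real_derivative
           (- (sphere_grad (Dh t) \<eta> \<bullet> X t \<eta>) - v t \<bullet> \<eta>
            + k * (g_field v t \<eta> \<bullet> (Dh t \<eta> *\<^sub>R f_field \<omega> t \<eta> + g_field v t \<eta> - Dh t \<eta> *\<^sub>R X t \<eta>))))
          (at t within {0..})) \<longleftrightarrow>
      (\<forall>M\<in>\<Sigma>. ((\<lambda>\<tau>. Dh \<tau> (view \<tau> M)) has_real_derivative
        - (v t \<bullet> view t M) - k * rate t M * (Dh t (view t M) - D t (view t M))) (at t within {0..}))"
    (is "?A \<longleftrightarrow> ?B") if t: "t \<ge> 0" for t
  proof
    assume A: ?A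
    show ?B
    proof
      fix M assume M: "M \<in> \<Sigma>"
      show "((\<lambda>\<tau>. Dh \<tau> (view \<tau> M)) has_real_derivative
        - (v t \<bullet> view t M) - k * rate t M * (Dh t (view t M) - D t (view t M))) (at t within {0..})"
        using bspec[OF A view_sphere[OF t M]] unfolding eq[OF t norm_view[OF t M]]
        by (simp only: point_view[OF t M] rate_def)
    qed
  next
    assume B: ?B
    show ?A
    proof
      fix \<eta> :: "real^3" assume "\<eta> \<in> sphere 0 1"
      then have \<eta>: "norm \<eta> = 1" by simp
      show "((\<lambda>\<tau>. Dh \<tau> \<eta>) has_real_derivative
           (- (sphere_grad (Dh t) \<eta> \<bullet> X t \<eta>) - v t \<bullet> \<eta>
            + k * (g_field v t \<eta> \<bullet> (Dh t \<eta> *\<^sub>R f_field \<omega> t \<eta> + g_field v t \<eta> - Dh t \<eta> *\<^sub>R X t \<eta>))))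
          (at t within {0..})"
        unfolding eq[OF t \<eta>]
        using bspec[OF B point_in[OF t \<eta>]] by (simp only: view_point[OF t \<eta>] rate_def)
    qed
  qed
  with True show ?thesis
    unfolding observer_solution_def by simp
qed (simp add: observer_solution_def)

lemma observer_error:
  assumes obs: "observer_solution k v \<omega> \<Gamma> D\<^sub>0 Dh" and t: "t \<ge> 0" and M: "M \<in> \<Sigma>"
  shows "Dh t (view t M) - D t (view t M) = (D\<^sub>0 (view 0 M) - D 0 (view 0 M)) * exp (- k * gain t M)"
proof -
  let ?E = "\<lambda>\<tau>. Dh \<tau> (view \<tau> M) - D \<tau> (view \<tau> M)"
  \<comment> \<open>\<open>exp (k * gain \<tau> M)\<close> is an integrating factor of the linear
    equation for the error.\<close>
  have "((\<lambda>\<tau>. ?E \<tau> * exp (k * gain \<tau> M)) has_real_derivative 0) (at \<tau> within {0..})" if \<tau>: "\<tau> \<ge> 0" for \<tau>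
  proof -
    have "((\<lambda>\<tau>. Dh \<tau> (view \<tau> M)) has_real_derivative - (v \<tau> \<bullet> view \<tau> M) - k * rate \<tau> M * ?E \<tau>) (at \<tau> within {0..})"
      using obs \<tau> M unfolding observer_solution_iff by blast
    from DERIV_diff[OF this D_along_view[OF \<tau> M]]
    have E: "(?E has_real_derivative - (k * rate \<tau> M * ?E \<tau>)) (at \<tau> within {0..})"
      by simp
    have "((\<lambda>\<tau>. exp (k * gain \<tau> M)) has_real_derivative exp (k * gain \<tau> M) * (k * rate \<tau> M)) (at \<tau> within {0..})"
      by (rule DERIV_chain'[where g = exp and f = "\<lambda>\<tau>. k * gain \<tau> M", OF DERIV_cmult[OF gain_deriv[OF \<tau> M]] DERIV_exp])
    from DERIV_mult'[OF E this] show ?thesis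
      by (rule DERIV_cong) simp
  qed
  then have "?E t * exp (k * gain t M) = ?E 0 * exp (k * gain 0 M)"
    unfolding has_real_derivative_iff_has_vector_derivative
    by (rule constant_on_Ici[where f = "\<lambda>\<tau>. ?E \<tau> * exp (k * gain \<tau> M)", OF _ t])
  moreover have "Dh 0 (view 0 M) = D\<^sub>0 (view 0 M)"
    using obs view_sphere[of 0 M] M unfolding observer_solution_iff by simp
  ultimately show ?thesis
    by (simp add: gain_0 exp_minus field_simps)
qed

text \<open>The error formula solved for the estimate, with the label \<open>M\<close> replaced by
  the scene point seen in direction \<eta> at time \<open>t\<close>.\<close>

definition observer :: "real \<Rightarrow> (real^3 \<Rightarrow> real) \<Rightarrow> real \<Rightarrow> real^3 \<Rightarrow> real" where
  "observer k D\<^sub>0 t \<eta> = D t \<eta> +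
     (D\<^sub>0 (view 0 (point t \<eta>)) - D 0 (view 0 (point t \<eta>))) * exp (- k * gain t (point t \<eta>))"

lemma C1_D_slice: "C1_on (sphere 0 1) (D 0)"
  using C1_on_compose[OF C1_on_Pair[OF C1_on_const C1_on_ident] C1_D, of "sphere 0 1" 0] by simp

lemma C1_observer:
  assumes "C1_on (sphere 0 1) D\<^sub>0"
  shows "C1_on time_sphere (\<lambda>p. observer k D\<^sub>0 (fst p) (snd p))"
proof -
  have "C1_on time_sphere (\<lambda>p. view 0 (point (fst p) (snd p)))"
    by (rule C1_on_compose[OF C1_point C1_view]) (auto simp: point_in)
  then have "C1_on time_sphere (\<lambda>p. D\<^sub>0 (view 0 (point (fst p) (snd p))) - D 0 (view 0 (point (fst p) (snd p))))"
    by (intro C1_on_compose[OF _ C1_on_diff[OF assms C1_D_slice]]) (auto simp: point_in norm_view)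
  moreover have "C1_on time_sphere (\<lambda>p. gain (fst p) (point (fst p) (snd p)))"
  proof -
    have "C1_on time_sphere (\<lambda>p. (fst p, point (fst p) (snd p)))"
      by (intro C1_on_Pair C1_point C1_on_fst C1_on_ident)
    from C1_on_compose[OF this C1_gain] show ?thesis
      by (auto simp: point_in)
  qed
  ultimately show ?thesis
    unfolding observer_def
    by (intro C1_on_add C1_D C1_on_mult C1_on_exp C1_on_const)
qed

lemma observer_solves:
  assumes "C1_on (sphere 0 1) D\<^sub>0"
  shows "observer_solution k v \<omega> \<Gamma> D\<^sub>0 (observer k D\<^sub>0)"
  unfolding observer_solution_iff
proof (intro conjI ballI allI impI)
  show "(\<lambda>(t, \<eta>). observer k D\<^sub>0 t \<eta>) differentiable_on time_sphere"
    using C1_on_differentiable_on[OF C1_observer[OF assms]] by (simp only: case_prod_beta')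
  show "observer k D\<^sub>0 0 \<eta> = D\<^sub>0 \<eta>" if "\<eta> \<in> sphere 0 1" for \<eta>
    using that by (simp add: observer_def view_point gain_0)
  fix t :: real and M assume t: "t \<ge> 0" and M: "M \<in> \<Sigma>"
  let ?E0 = "D\<^sub>0 (view 0 M) - D 0 (view 0 M)"
  have obs: "observer k D\<^sub>0 \<tau> (view \<tau> M) = D \<tau> (view \<tau> M) + ?E0 * exp (- k * gain \<tau> M)" if "\<tau> \<ge> 0" for \<tau>
    by (simp only: observer_def point_view[OF that M])
  have "((\<lambda>\<tau>. exp (- k * gain \<tau> M)) has_real_derivative exp (- k * gain t M) * (- k * rate t M)) (at t within {0..})"
    by (rule DERIV_chain'[where g = exp and f = "\<lambda>\<tau>. - k * gain \<tau> M", OF DERIV_cmult[OF gain_deriv[OF t M]] DERIV_exp])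
  from DERIV_add[OF D_along_view[OF t M] DERIV_cmult[OF this, of ?E0]]
  have d: "((\<lambda>\<tau>. observer k D\<^sub>0 \<tau> (view \<tau> M)) has_real_derivative
      - (v t \<bullet> view t M) + ?E0 * (exp (- k * gain t M) * (- k * rate t M))) (at t within {0..})"
    by (rule has_derivative_Ici_cong[OF _ t obs])
  have e: "- (v t \<bullet> view t M) + ?E0 * (exp (- k * gain t M) * (- k * rate t M)) =
      - (v t \<bullet> view t M) - k * rate t M * (observer k D\<^sub>0 t (view t M) - D t (view t M))"
    unfolding obs[OF t] by simp
  show "((\<lambda>\<tau>. observer k D\<^sub>0 \<tau> (view \<tau> M)) has_real_derivative - (v t \<bullet> view t M)
      - k * rate t M * (observer k D\<^sub>0 t (view t M) - D t (view t M))) (at t within {0..})"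
    using d unfolding e .
qed

lemma observer_unique:
  assumes "observer_solution k v \<omega> \<Gamma> D\<^sub>0 Dh" "t \<ge> 0" "\<eta> \<in> sphere 0 1"
  shows "Dh t \<eta> = observer k D\<^sub>0 t \<eta>"
proof -
  have "norm \<eta> = 1" using assms(3) by simp
  from observer_error[OF assms(1,2) point_in[OF assms(2) this]] show ?thesis
    by (simp add: observer_def view_point assms(2) \<open>norm \<eta> = 1\<close>)
qed

end

subsection \<open>Convergence\<close>

text \<open>The density \<open>sin\<close> is at most 1, so the total mass is bounded by the area of
  the parameter rectangle.\<close>

lemma
  shows finite_sphere_measure: "finite_measure sphere_measure"
    and space_sphere_measure: "space sphere_measure = sphere 0 1"
proof -
  let ?P = "{(\<theta>, \<phi>). 0 \<le> \<theta> \<and> \<theta> \<le> pi \<and> 0 \<le> \<phi> \<and> \<phi> \<le> 2 * pi} :: (real \<times> real) set"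
  let ?M = "density (restrict_space lborel ?P) (\<lambda>(\<theta>, \<phi>). ennreal (sin \<theta>))"
  have P: "?P = cbox (0, 0) (pi, 2 * pi)"
    by (auto simp: cbox_Pair_eq)
  have Pm: "?P \<in> sets lborel"
    unfolding P by simp
  have sp: "space ?M = ?P"
    by (simp add: space_restrict_space)
  have sphere: "sphere_coord z \<in> sphere 0 1" for z
  proof -
    have "(sin (fst z) * cos (snd z))\<^sup>2 + (sin (fst z) * sin (snd z))\<^sup>2 + (cos (fst z))\<^sup>2 =
        (sin (fst z))\<^sup>2 * ((cos (snd z))\<^sup>2 + (sin (snd z))\<^sup>2) + (cos (fst z))\<^sup>2"
      by (simp only: power_mult_distrib distrib_left)
    also have "\<dots> = 1"
      by simp
    finally show ?thesis
      by (simp add: sphere_coord_def case_prod_beta norm_eq_sqrt_inner inner_vec_def sum_3 power2_eq_square)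
  qed
  have "continuous_on UNIV sphere_coord"
    unfolding sphere_coord_def case_prod_beta vector_def
    by (subst continuous_on_componentwise) (auto simp: Basis_vec_def inner_axis forall_3 vector_3 intro!: continuous_intros)
  then have "sphere_coord \<in> measurable borel borel"
    by (rule borel_measurable_continuous_onI)
  then have meas: "sphere_coord \<in> measurable ?M (restrict_space borel (sphere 0 1))"
    by (intro measurable_restrict_space2) (use sphere in \<open>auto simp: measurable_restrict_space1\<close>)
  have "(\<lambda>z::real \<times> real. sin (fst z)) \<in> borel_measurable borel"
    by (intro borel_measurable_continuous_onI continuous_intros)
  then have "(\<lambda>z::real \<times> real. ennreal (sin (fst z))) \<in> borel_measurable borel"
    by (rule measurable_compose[OF _ measurable_ennreal])
  then have f: "(\<lambda>(\<theta>, \<phi>). ennreal (sin \<theta>)) \<in> borel_measurable (restrict_space lborel ?P)"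
    unfolding case_prod_beta by (intro measurable_restrict_space1) simp
  have "?P \<in> sets (restrict_space lborel ?P)"
    using sets.top[of "restrict_space lborel ?P"]
    by (simp only: space_restrict_space space_lborel space_borel Int_UNIV_right)
  then have "emeasure ?M ?P =
      (\<integral>\<^sup>+z. (case z of (\<theta>, \<phi>) \<Rightarrow> ennreal (sin \<theta>)) * indicator ?P z \<partial>restrict_space lborel ?P)"
    by (rule emeasure_density[OF f])
  also have "\<dots> \<le> (\<integral>\<^sup>+z. 1 \<partial>restrict_space lborel ?P)"
  proof (rule nn_integral_mono)
    show "(case z of (\<theta>, \<phi>) \<Rightarrow> ennreal (sin \<theta>)) * indicator ?P z \<le> 1" for z
      by (cases z) (simp add: indicator_def ennreal_le_1)
  qed
  also have "\<dots> = emeasure lborel ?P"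
  proof -
    have "(\<integral>\<^sup>+z. 1 \<partial>restrict_space lborel ?P) = emeasure (restrict_space lborel ?P) (space (restrict_space lborel ?P))"
      by (simp only: nn_integral_const mult_1_left)
    also have "\<dots> = emeasure (restrict_space lborel ?P) ?P"
      by (simp only: space_restrict_space space_lborel space_borel Int_UNIV_right)
    also have "\<dots> = emeasure lborel ?P"
      using Pm by (intro emeasure_restrict_space) simp_all
    finally show ?thesis .
  qed
  also have "\<dots> < \<infinity>"
    unfolding P by (rule emeasure_lborel_cbox_finite)
  finally have "emeasure ?M (space ?M) < \<infinity>"
    unfolding sp .
  then have "finite_measure ?M"
    by (intro finite_measureI) (simp only: infinity_ennreal_def less_top)
  then show "finite_measure sphere_measure"
    unfolding sphere_measure_def by (rule finite_measure.finite_measure_distr[OF _ meas])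
  show "space sphere_measure = sphere 0 1"
    by (simp add: sphere_measure_def space_restrict_space)
qed

text \<open>Measurability of \<open>f\<close> need not be established: a function that is not
  integrable has integral 0 by convention, which \<open>c \<ge> 0\<close> covers.\<close>

lemma (in finite_measure) integral_le_bound:
  fixes f :: "'a \<Rightarrow> real"
  assumes "\<And>x. x \<in> space M \<Longrightarrow> f x \<le> c" "c \<ge> 0"
  shows "integral\<^sup>L M f \<le> c * measure M (space M)"
proof (cases "integrable M f")
  case True
  then have "integral\<^sup>L M f \<le> (\<integral>x. c \<partial>M)"
    by (intro integral_mono) (use assms in auto)
  then show ?thesis
    by (simp add: mult.commute)
next
  case False
  then show ?thesis
    using assms(2) by (simp add: not_integrable_integral_eq)
qed

lemma sphere_Lp_tendsto_0:
  fixes h :: "real \<Rightarrow> real^3 \<Rightarrow> real"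
  assumes h: "\<And>t \<eta>. t \<ge> 0 \<Longrightarrow> norm \<eta> = 1 \<Longrightarrow> \<bar>h t \<eta>\<bar> \<le> B t" and B: "(B \<longlongrightarrow> 0) at_top" and p: "p > 0"
  shows "((\<lambda>t::real. \<integral>\<eta>. \<bar>h t \<eta>\<bar> powr p \<partial>sphere_measure) \<longlongrightarrow> 0) at_top"
proof -
  interpret finite_measure sphere_measure
    by (rule finite_sphere_measure)
  have B0: "B t \<ge> 0" if "t \<ge> 0" for t
  proof -
    \<comment> \<open>Any one point of the sphere shows that \<open>B t\<close> bounds an absolute
      value.\<close>
    have "norm (axis 1 1 :: real^3) = 1"
      by simp
    from order_trans[OF abs_ge_zero h[OF that this]] show ?thesis .
  qed
  have B_ev: "\<forall>\<^sub>F t in at_top. 0 \<le> B t"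
    using eventually_ge_at_top[of 0] by eventually_elim (rule B0)
  have "((\<lambda>t. B t powr p) \<longlongrightarrow> 0) at_top"
    by (rule tendsto_zero_powrI[where g = "\<lambda>_. p" and b = p, OF B tendsto_const B_ev p])
  from tendsto_mult_left_zero[OF this, of "measure sphere_measure (space sphere_measure)"]
  have lim: "((\<lambda>t. B t powr p * measure sphere_measure (space sphere_measure)) \<longlongrightarrow> 0) at_top" .
  show ?thesis
  proof (rule tendsto_sandwich[OF _ _ tendsto_const lim])
    show "\<forall>\<^sub>F t in at_top. 0 \<le> (\<integral>\<eta>. \<bar>h t \<eta>\<bar> powr p \<partial>sphere_measure)"
      by simp
    show "\<forall>\<^sub>F t in at_top. (\<integral>\<eta>. \<bar>h t \<eta>\<bar> powr p \<partial>sphere_measure)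
        \<le> B t powr p * measure sphere_measure (space sphere_measure)"
      using eventually_ge_at_top[of 0]
    proof eventually_elim
      case (elim t)
      show ?case
        by (rule integral_le_bound)
          (use h[OF elim] p in \<open>auto simp: space_sphere_measure intro!: powr_mono2\<close>)
    qed
  qed
qed

text \<open>Divergence is assumed for an \<open>nn_integral\<close> over the half-line, while
  \<open>gain\<close> is a gauge integral over [0, t]. Monotone convergence along the integers
  connects the two.\<close>

lemma nn_integral_Ici_bounded:
  fixes f :: "real \<Rightarrow> real"
  assumes cont: "continuous_on {0..} f" and nonneg: "\<And>t. t \<ge> 0 \<Longrightarrow> f t \<ge> 0"
    and bound: "\<And>n::nat. integral {0..real n} f \<le> K"
  shows "(\<integral>\<^sup>+t\<in>{0..}. ennreal (f t) \<partial>lborel) \<le> ennreal K"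
proof -
  let ?F = "\<lambda>n t. indicator {0..real n} t * ennreal (f t)"
  have intg: "f integrable_on {0..real n}" for n
    by (rule integrable_continuous_interval, rule continuous_on_subset[OF cont]) auto
  have meas: "?F n \<in> borel_measurable lborel" for n
  proof -
    have "(\<lambda>t. indicator {0..real n} t *\<^sub>R f t) \<in> borel_measurable borel"
      by (rule borel_measurable_continuous_on_indicator) (auto intro: continuous_on_subset[OF cont])
    then have "(\<lambda>t. ennreal (indicator {0..real n} t *\<^sub>R f t)) \<in> borel_measurable borel"
      by simp
    moreover have "(\<lambda>t. ennreal (indicator {0..real n} t *\<^sub>R f t)) = ?F n"
      by (auto simp: indicator_def)
    ultimately show ?thesis
      by simp
  qed
  have sup: "(SUP n. ?F n t) = ennreal (f t) * indicator {0..} t" for t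
  proof (cases "t \<ge> 0")
    case True
    obtain m :: nat where m: "t \<le> real m"
      using real_arch_simple by blast
    have "(SUP n. ?F n t) = ennreal (f t)"
    proof (rule antisym)
      show "(SUP n. ?F n t) \<le> ennreal (f t)"
        by (rule SUP_least) (simp add: indicator_def)
      have "ennreal (f t) = ?F m t"
        using True m by simp
      also have "\<dots> \<le> (SUP n. ?F n t)"
        by (rule SUP_upper) simp
      finally show "ennreal (f t) \<le> (SUP n. ?F n t)" .
    qed
    with True show ?thesis
      by simp
  qed (simp add: indicator_def)
  have "(\<integral>\<^sup>+t\<in>{0..}. ennreal (f t) \<partial>lborel) = (\<integral>\<^sup>+t. (SUP n. ?F n t) \<partial>lborel)"
    by (simp only: sup)
  also have "\<dots> = (SUP n. \<integral>\<^sup>+t. ?F n t \<partial>lborel)"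
    by (rule nn_integral_monotone_convergence_SUP[OF _ meas])
      (auto simp: incseq_def le_fun_def indicator_def)
  also have "\<dots> = (SUP n. ennreal (integral {0..real n} f))"
  proof -
    have "(\<integral>\<^sup>+t. ?F n t \<partial>lborel) = ennreal (integral {0..real n} f)" for n
    proof -
      have "(\<integral>\<^sup>+t. indicator {0..real n} t * f t \<partial>lborel) = ennreal (integral {0..real n} f)"
        by (rule nn_integral_has_integral_lebesgue) (use nonneg intg in auto)
      moreover have "ennreal (indicator {0..real n} t * f t) = ?F n t" for t
        by (simp add: indicator_def)
      ultimately show ?thesis
        by simp
    qed
    then show ?thesis
      by simp
  qed
  also have "\<dots> \<le> ennreal K"
    using bound by (intro SUP_least ennreal_leI)
  finally show ?thesis .
qed

context camera begin

text \<open>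
  By compactness of the scene, the pointwise divergence of the monotone gains is uniform, as in
  Dini's theorem. So the error tends to zero uniformly and no change of variables along the flow is
  needed to bound its \<open>L\<^sup>p\<close> norms.
\<close>

lemma gain_uniformly_unbounded:
  assumes unbounded: "\<And>M K. M \<in> \<Sigma> \<Longrightarrow> \<exists>n::nat. gain (real n) M > K"
  shows "\<exists>N. \<forall>t\<ge>real N. \<forall>M\<in>\<Sigma>. gain t M > K"
proof (rule ccontr)
  assume "\<nexists>N. \<forall>t\<ge>real N. \<forall>M\<in>\<Sigma>. gain t M > K"
  \<comment> \<open>Gains increase with time, so a point still below \<open>K\<close> at some
    \<open>t \<ge> N\<close> is below \<open>K\<close> at \<open>N\<close>.\<close>
  then have "\<forall>N. \<exists>M\<in>\<Sigma>. gain (real N) M \<le> K"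
    using gain_mono by (meson not_le of_nat_0_le_iff order_trans)
  then obtain m where m: "\<And>N. m N \<in> \<Sigma>" "\<And>N. gain (real N) (m N) \<le> K"
    by metis
  obtain M r where M: "M \<in> \<Sigma>" and r: "strict_mono r" "(m \<circ> r) \<longlonglongrightarrow> M"
    using compact_\<Sigma> m(1) unfolding compact_def by metis
  obtain N where N: "gain (real N) M > K"
    using unbounded[OF M] by blast
  have "continuous_on \<Sigma> (gain (real N))"
    using C1_on_continuous_on[OF C1_on_compose[OF C1_on_Pair[OF C1_on_const C1_on_ident] C1_gain], of \<Sigma> "real N"]
    by auto
  then have "(\<lambda>i. gain (real N) ((m \<circ> r) i)) \<longlonglongrightarrow> gain (real N) M"
    using r(2) M by (rule continuous_on_tendsto_compose) (simp add: m(1))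
  then have "\<forall>\<^sub>F i in sequentially. K < gain (real N) (m (r i))"
    using N order_tendstoD(1) by fastforce
  then have "\<forall>\<^sub>F i in sequentially. K < gain (real N) (m (r i)) \<and> N \<le> i"
    using eventually_ge_at_top[of N] by (rule eventually_conj)
  then obtain i where i: "K < gain (real N) (m (r i))" "N \<le> i"
    using eventually_happens'[OF sequentially_bot] by blast
  \<comment> \<open>A subsequence satisfies \<open>i \<le> r i\<close>, so
    \<open>N \<le> r i\<close> and monotonicity carries the bound \<open>K\<close> from time
    \<open>r i\<close> back to the fixed time \<open>N\<close>.\<close>
  have "gain (real N) (m (r i)) \<le> gain (real (r i)) (m (r i))"
    using i(2) seq_suble[OF r(1), of i] by (intro gain_mono m) auto
  then show False
    using i(1) m(2)[of "r i"] by simp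
qed

text \<open>By contraposition: a gain bounded by \<open>K\<close> bounds the integral of |g|^2 over
  each [0, n] by \<open>K / \<gamma>bar\<close>, hence over the half-line.\<close>

lemma gain_unbounded:
  assumes "(\<integral>\<^sup>+\<tau>\<in>{0..}. ennreal ((norm (g_field v \<tau> (view \<tau> M)))\<^sup>2) \<partial>lborel) = \<infinity>" and M: "M \<in> \<Sigma>"
  shows "\<exists>n::nat. gain (real n) M > K"
proof (rule ccontr)
  assume "\<nexists>n::nat. gain (real n) M > K"
  then have "gain (real n) M \<le> K" for n
    by (simp add: not_less)
  then have "integral {0..real n} (\<lambda>\<tau>. (norm (g_field v \<tau> (view \<tau> M)))\<^sup>2) \<le> K / \<gamma>bar" for n
    using gain_ge[OF M, of "real n"] pos(1) by (smt (verit) mult.commute pos_le_divide_eq)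
  then have "(\<integral>\<^sup>+\<tau>\<in>{0..}. ennreal ((norm (g_field v \<tau> (view \<tau> M)))\<^sup>2) \<partial>lborel) \<le> ennreal (K / \<gamma>bar)"
    by (intro nn_integral_Ici_bounded cont_g_view M) auto
  then show False
    using assms(1) by (simp add: top_unique)
qed

section \<open>Estimates for the error of a given solution\<close>

context
  fixes k :: real and D\<^sub>0 :: "real^3 \<Rightarrow> real" and Dh :: "real \<Rightarrow> real^3 \<Rightarrow> real"
  assumes k: "k > 0" and D0: "C1_on (sphere 0 1) D\<^sub>0" and obs: "observer_solution k v \<omega> \<Gamma> D\<^sub>0 Dh"
begin

abbreviation err :: "real \<Rightarrow> real^3 \<Rightarrow> real" where "err t \<eta> \<equiv> Dh t \<eta> - D t \<eta>"

text \<open>The given solution is only assumed differentiable; by uniqueness it inherits regularity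
  from the explicit one.\<close>

lemma C1_slice:
  assumes t: "t \<ge> 0"
  shows "C1_on (sphere 0 1) (Dh t)" "C1_on (sphere 0 1) (D t)"
proof -
  have slice: "C1_on (sphere 0 1) (\<lambda>\<eta>. (t, \<eta>))"
    by (intro C1_on_Pair C1_on_const C1_on_ident)
  show "C1_on (sphere 0 1) (D t)"
    using C1_on_compose[OF slice C1_D] t by simp
  have "C1_on (sphere 0 1) (observer k D\<^sub>0 t)"
    using C1_on_compose[OF slice C1_observer[OF D0]] t by simp
  then show "C1_on (sphere 0 1) (Dh t)"
    using C1_on_cong[of "sphere 0 1" "Dh t" "observer k D\<^sub>0 t"] observer_unique[OF obs t] by simp
qed

lemma cont_err: "t \<ge> 0 \<Longrightarrow> continuous_on (sphere 0 1) (err t)"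
  by (intro C1_on_continuous_on C1_on_diff C1_slice)

lemmas err_attained = sphere_sup_norm_attained(1)[OF cont_err]
lemmas err_le = sphere_sup_norm_attained(2)[OF cont_err]

lemma err_nonneg: "t \<ge> 0 \<Longrightarrow> sphere_sup_norm (err t) \<ge> 0"
  using err_attained[of t] by auto

lemma err_view:
  assumes "t \<ge> 0" "M \<in> \<Sigma>"
  shows "err t (view t M) = err 0 (view 0 M) * exp (- k * gain t M)"
  using observer_error[OF obs assms] observer_error[OF obs _ assms(2), of 0] by (simp add: gain_0)

text \<open>The scene point seen at time \<open>t\<close> in the direction of largest error is
  followed to its direction at time \<open>s\<close>. The case \<open>c = 0\<close> is monotonicity;
  the cases with \<open>s = 0\<close> give both convergence results.\<close>

lemma err_sup_le:
  assumes t: "0 \<le> s" "0 \<le> t" and c: "\<And>M. M \<in> \<Sigma> \<Longrightarrow> c \<le> gain t M - gain s M"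
  shows "sphere_sup_norm (err t) \<le> exp (- k * c) * sphere_sup_norm (err s)"
proof -
  obtain \<eta> where \<eta>: "\<eta> \<in> sphere 0 1" "sphere_sup_norm (err t) = \<bar>err t \<eta>\<bar>"
    using err_attained[OF t(2)] by blast
  define M where "M = point t \<eta>"
  have M: "M \<in> \<Sigma>" and \<eta>M: "view t M = \<eta>"
    using \<eta>(1) t(2) by (auto simp: M_def point_in view_point)
  have "err t \<eta> = err s (view s M) * exp (- k * (gain t M - gain s M))"
  proof -
    have "exp (- k * gain t M) = exp (- k * gain s M) * exp (- k * (gain t M - gain s M))"
      by (simp add: algebra_simps flip: exp_add)
    then show ?thesis
      using err_view[OF t(1) M] err_view[OF t(2) M] by (simp only: \<eta>M mult.assoc)
  qed
  then have "sphere_sup_norm (err t) = exp (- k * (gain t M - gain s M)) * \<bar>err s (view s M)\<bar>"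
    by (simp add: \<eta>(2) abs_mult mult.commute)
  also have "\<dots> \<le> exp (- k * c) * sphere_sup_norm (err s)"
    using c[OF M] k err_le[OF t(1) view_sphere[OF t(1) M]] by (intro mult_mono) auto
  finally show ?thesis .
qed

lemma err_antimono: "antimono_on {0..} (\<lambda>t. sphere_sup_norm (err t))"
proof (rule monotone_onI)
  fix s t :: real assume "s \<in> {0..}" "t \<in> {0..}" "s \<le> t"
  then show "sphere_sup_norm (err s) \<ge> sphere_sup_norm (err t)"
    using err_sup_le[of s t 0] gain_mono by simp
qed

lemma err_tendsto_0:
  assumes inf: "\<And>M. M \<in> \<Sigma> \<Longrightarrow>
      (\<integral>\<^sup>+\<tau>\<in>{0..}. ennreal ((norm (g_field v \<tau> (view \<tau> M)))\<^sup>2) \<partial>lborel) = \<infinity>"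
  shows "((\<lambda>t. sphere_sup_norm (err t)) \<longlongrightarrow> 0) at_top"
proof (rule tendstoI)
  fix e :: real assume e: "e > 0"
  \<comment> \<open>The summand 1 keeps \<open>B\<close> positive even if the initial error is 0 and
    makes the final inequality strict; \<open>K\<close> is then the gain that shrinks
    \<open>B\<close> to \<open>e\<close>.\<close>
  define B where "B = sphere_sup_norm (err 0) + 1"
  have B: "B > 0" using err_nonneg[of 0] by (simp add: B_def)
  define K where "K = - ln (e / B) / k"
  have KB: "exp (- k * K) * B = e"
    using e B k by (simp add: K_def)
  obtain N where N: "\<forall>t\<ge>real N. \<forall>M\<in>\<Sigma>. gain t M > K"
    using gain_uniformly_unbounded[OF gain_unbounded[OF inf]] by blast
  show "\<forall>\<^sub>F t in at_top. dist (sphere_sup_norm (err t)) 0 < e"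
    using eventually_ge_at_top[of "real N"]
  proof eventually_elim
    case (elim t)
    then have t: "t \<ge> 0"
      by (rule order_trans[OF of_nat_0_le_iff])
    have "sphere_sup_norm (err t) \<le> exp (- k * K) * sphere_sup_norm (err 0)"
      by (rule err_sup_le) (use t N elim in \<open>auto simp: gain_0 less_imp_le\<close>)
    also have "\<dots> < exp (- k * K) * B"
      by (simp add: B_def)
    finally show ?case
      using KB err_nonneg[OF t] by simp
  qed
qed

lemma err_exponential:
  assumes lam: "\<And>M. M \<in> \<Sigma> \<Longrightarrow> lam * t \<le> integral {0..t} (\<lambda>\<tau>. (norm (g_field v \<tau> (view \<tau> M)))\<^sup>2)" and t: "t \<ge> 0"
  shows "sphere_sup_norm (err t) \<le> exp (- k * \<gamma>bar * lam * t) * sphere_sup_norm (err 0)"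
proof -
  have "\<gamma>bar * (lam * t) \<le> gain t M" if "M \<in> \<Sigma>" for M
    using order_trans[OF mult_left_mono[OF lam[OF that] less_imp_le[OF pos(1)]] gain_ge[OF that]] .
  then show ?thesis
    using err_sup_le[of 0 t "\<gamma>bar * (lam * t)"] t by (simp add: gain_0 mult.assoc)
qed

end

end



theorem theorem1:
  fixes \<Omega> \<Sigma> :: "(real^3) set"
    and C v \<omega> :: "real \<Rightarrow> real^3" and q :: "real \<Rightarrow> quat"
    and D \<Gamma> :: "real \<Rightarrow> real^3 \<Rightarrow> real"
    and vbar \<omega>bar \<gamma>bar \<Gamma>bar k :: real
    and D\<^sub>0 :: "real^3 \<Rightarrow> real"
  assumes scene: "convex_C1_scene \<Omega> \<Sigma>"
    and motion: "camera_motion \<Omega> C q v \<omega>"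
    and D: "D = (\<lambda>t \<eta>. depth \<Sigma> (C t) (q t) \<eta>)"
    and \<Gamma>: "\<Gamma> = (\<lambda>t \<eta>. 1 / D t \<eta>)"
    and pos: "vbar > 0" "\<omega>bar > 0" "\<gamma>bar > 0" "\<Gamma>bar > 0"
    and bounds: "\<forall>t\<ge>0. \<forall>\<eta>\<in>sphere 0 1.
      norm (v t) \<le> vbar \<and> norm (\<omega> t) \<le> \<omega>bar \<and> \<gamma>bar \<le> \<Gamma> t \<eta> \<and> \<Gamma> t \<eta> \<le> \<Gamma>bar"
    and k: "k > 0"
    and D0: "C1_on (sphere 0 1) D\<^sub>0"
  shows
    "C1_on time_sphere (\<lambda>(t, \<eta>). \<Gamma> t \<eta>) \<and>
     (\<forall>t\<ge>0. \<forall>\<eta>\<in>sphere 0 1.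
        ((\<lambda>\<tau>. \<Gamma> \<tau> \<eta>) has_real_derivative
           (- (sphere_grad (\<Gamma> t) \<eta> \<bullet> cross3 \<eta> (\<omega> t + \<Gamma> t \<eta> *\<^sub>R cross3 \<eta> (v t)))
            + (\<Gamma> t \<eta>)\<^sup>2 * (v t \<bullet> \<eta>)))
          (at t within {0..})) \<and>
     (\<exists>\<phi>. is_sphere_flow (flow_field v \<omega> \<Gamma>) \<phi>) \<and>
     (\<exists>Dh. observer_solution k v \<omega> \<Gamma> D\<^sub>0 Dh \<and> C1_on time_sphere (\<lambda>(t, \<eta>). Dh t \<eta>)) \<and>
     (\<forall>Dh Dh'. observer_solution k v \<omega> \<Gamma> D\<^sub>0 Dh \<longrightarrow> observer_solution k v \<omega> \<Gamma> D\<^sub>0 Dh' \<longrightarrow>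
        (\<forall>t\<ge>0. \<forall>\<eta>\<in>sphere 0 1. Dh t \<eta> = Dh' t \<eta>)) \<and>
     (\<forall>Dh. observer_solution k v \<omega> \<Gamma> D\<^sub>0 Dh \<longrightarrow>
        (\<forall>t\<ge>0. C1_on (sphere 0 1) (Dh t)) \<and>
        (\<forall>t\<ge>0. \<exists>\<eta>\<in>sphere 0 1.
           sphere_sup_norm (\<lambda>\<eta>. Dh t \<eta> - D t \<eta>) = \<bar>Dh t \<eta> - D t \<eta>\<bar>) \<and>
        antimono_on {0..} (\<lambda>t. sphere_sup_norm (\<lambda>\<eta>. Dh t \<eta> - D t \<eta>)) \<and>
        (\<forall>\<phi>. is_sphere_flow (flow_field v \<omega> \<Gamma>) \<phi> \<longrightarrow>
           ((\<forall>s\<in>sphere 0 1.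
               (\<integral>\<^sup>+\<tau>\<in>{0..}. ennreal ((norm (g_field v \<tau> (\<phi> \<tau> s)))\<^sup>2) \<partial>lborel) = \<infinity>) \<longrightarrow>
            (\<forall>p>0. ((\<lambda>t. \<integral>\<eta>. \<bar>Dh t \<eta> - D t \<eta>\<bar> powr p \<partial>sphere_measure) \<longlongrightarrow> 0) at_top)) \<and>
           (\<forall>lam T. lam > 0 \<longrightarrow> T > 0 \<longrightarrow>
              (\<forall>t\<ge>T. \<forall>s\<in>sphere 0 1.
                 integral {0..t} (\<lambda>\<tau>. (norm (g_field v \<tau> (\<phi> \<tau> s)))\<^sup>2) \<ge> lam * t) \<longrightarrow>
              (\<forall>t\<ge>T. sphere_sup_norm (\<lambda>\<eta>. Dh t \<eta> - D t \<eta>)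
                 \<le> exp (- k * \<gamma>bar * lam * t) * sphere_sup_norm (\<lambda>\<eta>. Dh 0 \<eta> - D 0 \<eta>)))))"
proof -
  interpret camera \<Omega> \<Sigma> C v \<omega> q D \<Gamma> \<gamma>bar \<Gamma>bar
    by unfold_locales (use scene motion D \<Gamma> pos bounds in auto)
  \<comment> \<open>The excitation conditions concern an arbitrary flow \<open>\<phi>\<close>;
    uniqueness translates them into conditions on scene points, with
    \<open>s = view 0 M\<close>.\<close>
  have flow_view: "\<phi> \<tau> (view 0 M) = view \<tau> M"
    if "is_sphere_flow (flow_field v \<omega> \<Gamma>) \<phi>" "\<tau> \<ge> 0" "M \<in> \<Sigma>" for \<phi> \<tau> M
    using flow_unique[OF that(1) view_sphere[of 0 M] that(2)] that(3) by (simp add: point_view)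
  show ?thesis
  proof (intro conjI allI impI ballI)
    show "C1_on time_sphere (\<lambda>(t, \<eta>). \<Gamma> t \<eta>)"
      using C1_\<Gamma> by (simp only: case_prod_beta')
    show "((\<lambda>\<tau>. \<Gamma> \<tau> \<eta>) has_real_derivative
        - (sphere_grad (\<Gamma> t) \<eta> \<bullet> cross3 \<eta> (\<omega> t + \<Gamma> t \<eta> *\<^sub>R cross3 \<eta> (v t))) + (\<Gamma> t \<eta>)\<^sup>2 * (v t \<bullet> \<eta>))
        (at t within {0..})" if "t \<ge> 0" "\<eta> \<in> sphere 0 1" for t \<eta>
      using \<Gamma>_equation[of t \<eta>] that by (simp add: flow_field_eq)
    show "\<exists>\<phi>. is_sphere_flow (flow_field v \<omega> \<Gamma>) \<phi>"
      using flow_exists by blast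
    show "\<exists>Dh. observer_solution k v \<omega> \<Gamma> D\<^sub>0 Dh \<and> C1_on time_sphere (\<lambda>(t, \<eta>). Dh t \<eta>)"
      using observer_solves[OF D0, of k] C1_observer[OF D0, of k] unfolding case_prod_beta' by blast
    show "Dh t \<eta> = Dh' t \<eta>" if "observer_solution k v \<omega> \<Gamma> D\<^sub>0 Dh" "observer_solution k v \<omega> \<Gamma> D\<^sub>0 Dh'"
      "t \<ge> 0" "\<eta> \<in> sphere 0 1" for Dh Dh' t \<eta>
      using observer_unique[OF that(1,3,4)] observer_unique[OF that(2,3,4)] by simp
    fix Dh assume obs: "observer_solution k v \<omega> \<Gamma> D\<^sub>0 Dh"
    show "C1_on (sphere 0 1) (Dh t)" if "t \<ge> 0" for t
      using C1_slice(1)[OF k D0 obs that] .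
    show "\<exists>\<eta>\<in>sphere 0 1. sphere_sup_norm (\<lambda>\<eta>. Dh t \<eta> - D t \<eta>) = \<bar>Dh t \<eta> - D t \<eta>\<bar>" if "t \<ge> 0" for t
      using err_attained[OF k D0 obs that] .
    show "antimono_on {0..} (\<lambda>t. sphere_sup_norm (\<lambda>\<eta>. Dh t \<eta> - D t \<eta>))"
      using err_antimono[OF k D0 obs] .
    fix \<phi> assume \<phi>: "is_sphere_flow (flow_field v \<omega> \<Gamma>) \<phi>"
    show "((\<lambda>t. \<integral>\<eta>. \<bar>Dh t \<eta> - D t \<eta>\<bar> powr p \<partial>sphere_measure) \<longlongrightarrow> 0) at_top"
      if inf: "\<forall>s\<in>sphere 0 1. (\<integral>\<^sup>+\<tau>\<in>{0..}. ennreal ((norm (g_field v \<tau> (\<phi> \<tau> s)))\<^sup>2) \<partial>lborel) = \<infinity>"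
        and "p > 0" for p :: real
    proof (rule sphere_Lp_tendsto_0[OF _ err_tendsto_0[OF k D0 obs] \<open>p > 0\<close>])
      show "\<bar>Dh t \<eta> - D t \<eta>\<bar> \<le> sphere_sup_norm (\<lambda>\<eta>. Dh t \<eta> - D t \<eta>)" if "t \<ge> 0" "norm \<eta> = 1" for t \<eta>
        using err_le[OF k D0 obs that(1)] that(2) by simp
      fix M assume M: "M \<in> \<Sigma>"
      \<comment> \<open>\<open>\<phi>\<close> is determined for nonnegative times only; the
        indicator of the half-line removes the others.\<close>
      have "(\<integral>\<^sup>+\<tau>\<in>{0..}. ennreal ((norm (g_field v \<tau> (view \<tau> M)))\<^sup>2) \<partial>lborel) =
          (\<integral>\<^sup>+\<tau>\<in>{0..}. ennreal ((norm (g_field v \<tau> (\<phi> \<tau> (view 0 M))))\<^sup>2) \<partial>lborel)"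
        by (rule nn_integral_cong) (simp add: indicator_def flow_view[OF \<phi> _ M])
      then show "(\<integral>\<^sup>+\<tau>\<in>{0..}. ennreal ((norm (g_field v \<tau> (view \<tau> M)))\<^sup>2) \<partial>lborel) = \<infinity>"
        using bspec[OF inf view_sphere[OF order_refl M]] by simp
    qed
    show "sphere_sup_norm (\<lambda>\<eta>. Dh t \<eta> - D t \<eta>)
        \<le> exp (- k * \<gamma>bar * lam * t) * sphere_sup_norm (\<lambda>\<eta>. Dh 0 \<eta> - D 0 \<eta>)"
      if "lam > 0" "T > 0" and lam: "\<forall>t\<ge>T. \<forall>s\<in>sphere 0 1.
          integral {0..t} (\<lambda>\<tau>. (norm (g_field v \<tau> (\<phi> \<tau> s)))\<^sup>2) \<ge> lam * t" and t: "t \<ge> T" for lam T t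
    proof (rule err_exponential[OF k D0 obs])
      show "t \<ge> 0" using t \<open>T > 0\<close> by simp
      fix M assume M: "M \<in> \<Sigma>"
      have eq: "integral {0..t} (\<lambda>\<tau>. (norm (g_field v \<tau> (\<phi> \<tau> (view 0 M))))\<^sup>2) =
          integral {0..t} (\<lambda>\<tau>. (norm (g_field v \<tau> (view \<tau> M)))\<^sup>2)"
        by (rule Henstock_Kurzweil_Integration.integral_cong) (simp add: flow_view[OF \<phi> _ M])
      show "lam * t \<le> integral {0..t} (\<lambda>\<tau>. (norm (g_field v \<tau> (view \<tau> M)))\<^sup>2)"
        using lam[rule_format, OF t view_sphere[OF order_refl M]] unfolding eq .
    qed
  qed
qed

end
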